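(* Let $\gamma\ge1$. There exists $\epsilon>0$ such that for all $v_+\in(1-\epsilon,1)$ and all $v_0\in(v_+,1)$ the compressive outflow boundary layer with parameters $(\gamma,v_0,v_+)$ is (spectrally) stable, i.e. the outflow eigenvalue problem has no eigenvalue $\lambda\ne0$ with $\operatorname{Re}\lambda\ge0$.
   Context: Parameters: $\gamma\ge1$, $0<v_+<v_0<1$, $a:=v_+^\gamma\frac{1-v_+}{1-v_+^\gamma}$. The compressive outflow boundary layer is the restriction to $x\le0$ of the (monotone decreasing) solution $\hat v$ on $\mathbb{R}$ of $\hat v'=\hat v\big(\hat v-1+a(\hat v^{-\gamma}-1)\big)$ with $\hat v(0)=v_0$; $\hat v(-\infty)=1$, $\hat v(+\infty)=v_+$. With $h(\hat v)=-\hat v^{\gamma+1}+a(\gamma-1)+(a+1)\hat v^\gamma$, the outflow eigenvalue problem (written in the "good unknown") is $$\lambda v+v'-u'=0,\qquad \lambda u+u'-\Big(\tfrac{h(\hat v)}{\hat v^{\gamma+1}}v\Big)'=\Big(\tfrac{u'}{\hat v}\Big)'\quad(x<0),$$ $$u(0)=\alpha(\lambda)v(0),\quad\alpha(\lambda):=\frac{-\hat v'(0)}{\lambda-\hat v'(0)},$$ with $(v,u)\to 0$ as $x\to-\infty$; $\lambda$ is an eigenvalue if there is a nontrivial solution. The change to the good unknown introduces a spurious eigenvalue at $\lambda=0$ (with $v=u=\hat v'$) which is not an eigenvalue of the original linearized problem and is disregarded in the definition of stability. *)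

theory Defs
  imports "HOL-Analysis.Analysis"
begin

definition profile_a :: "real \<Rightarrow> real \<Rightarrow> real" where
  "profile_a \<gamma> vp = vp powr \<gamma> * ((1 - vp) / (1 - vp powr \<gamma>))"

text \<open>The profile \<open>vh\<close> lives on the whole line; the boundary layer is its restriction to
  \<open>x \<le> 0\<close>, and only that part enters the eigenvalue problem below.\<close>

definition compressive_outflow_profile ::
    "real \<Rightarrow> real \<Rightarrow> real \<Rightarrow> (real \<Rightarrow> real) \<Rightarrow> bool" where
  "compressive_outflow_profile \<gamma> v0 vp vh \<longleftrightarrow>
     (\<forall>x. (vh has_real_derivative
            vh x * (vh x - 1 + profile_a \<gamma> vp * (vh x powr (-\<gamma>) - 1))) (at x)) \<and>
     vh 0 = v0 \<and>
     monotone (<) (>) vh \<and>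
     (vh \<longlongrightarrow> 1) at_bot \<and>
     (vh \<longlongrightarrow> vp) at_top"

definition outflow_h :: "real \<Rightarrow> real \<Rightarrow> real \<Rightarrow> real" where
  "outflow_h \<gamma> vp y =
     - (y powr (\<gamma> + 1)) + profile_a \<gamma> vp * (\<gamma> - 1) + (profile_a \<gamma> vp + 1) * y powr \<gamma>"

text \<open>At \<open>lam = deriv vh 0\<close> the quotient is the junk value \<open>0\<close>; since \<open>deriv vh 0 < 0\<close> for a
  profile, this point lies outside the half-plane \<open>Re lam \<ge> 0\<close>.\<close>

definition outflow_alpha :: "(real \<Rightarrow> real) \<Rightarrow> complex \<Rightarrow> complex" where
  "outflow_alpha vh lam = - of_real (deriv vh 0) / (lam - of_real (deriv vh 0))"

text \<open>Classical solutions on \<open>x < 0\<close>, continuous up to the boundary, so that \<open>u 0\<close> and \<open>v 0\<close>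
  are the boundary traces. The functions \<open>v'\<close>, \<open>u'\<close>, \<open>p'\<close>, \<open>q'\<close> are the derivatives of
  \<open>v\<close>, \<open>u\<close>, \<open>h(vh) / vh^(\<gamma>+1) * v\<close> and \<open>u' / vh\<close>.\<close>

definition outflow_eigenfunction ::
    "real \<Rightarrow> real \<Rightarrow> (real \<Rightarrow> real) \<Rightarrow> complex \<Rightarrow> (real \<Rightarrow> complex) \<Rightarrow> (real \<Rightarrow> complex) \<Rightarrow> bool" where
  "outflow_eigenfunction \<gamma> vp vh lam v u \<longleftrightarrow>
     (\<exists>v' u' p' q'. \<forall>x<0.
        (v has_vector_derivative v' x) (at x) \<and>
        (u has_vector_derivative u' x) (at x) \<and>
        ((\<lambda>y. complex_of_real (outflow_h \<gamma> vp (vh y) / vh y powr (\<gamma> + 1)) * v y)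
           has_vector_derivative p' x) (at x) \<and>
        ((\<lambda>y. u' y / of_real (vh y)) has_vector_derivative q' x) (at x) \<and>
        lam * v x + v' x - u' x = 0 \<and>
        lam * u x + u' x - p' x = q' x) \<and>
     continuous_on {..0} v \<and> continuous_on {..0} u \<and>
     u 0 = outflow_alpha vh lam * v 0 \<and>
     (v \<longlongrightarrow> 0) at_bot \<and> (u \<longlongrightarrow> 0) at_bot \<and>
     (\<exists>x\<le>0. v x \<noteq> 0 \<or> u x \<noteq> 0)"

definition outflow_eigenvalue ::
    "real \<Rightarrow> real \<Rightarrow> (real \<Rightarrow> real) \<Rightarrow> complex \<Rightarrow> bool" where
  "outflow_eigenvalue \<gamma> vp vh lam \<longleftrightarrow> (\<exists>v u. outflow_eigenfunction \<gamma> vp vh lam v u)"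

text \<open>The value \<open>lam = 0\<close> is excluded because it is always a spurious eigenvalue, created by the
  change to the good unknown (with \<open>v = u = deriv vh\<close>).\<close>

definition outflow_spectrally_stable :: "real \<Rightarrow> real \<Rightarrow> (real \<Rightarrow> real) \<Rightarrow> bool" where
  "outflow_spectrally_stable \<gamma> vp vh \<longleftrightarrow>
     \<not> (\<exists>lam. lam \<noteq> 0 \<and> Re lam \<ge> 0 \<and> outflow_eigenvalue \<gamma> vp vh lam)"

end

theory Submission
  imports Defs
begin

text \<open>
  Why the layers are stable. Let \<open>w\<close> be the profile, \<open>s = - w' > 0\<close>, and let \<open>b\<close> be the derivative of the
  right-hand side of the profile equation, evaluated along the profile, so that \<open>s' = b s\<close>. The
  eigenvalue equations are in divergence form, so for \<open>\<lambda> \<noteq> 0\<close> they can be integrated without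
  quadrature: \<open>V = (u - v) / \<lambda>\<close> and \<open>U = (u' / w + (h / w^(\<gamma>+1)) v - u) / \<lambda>\<close> are the primitives of \<open>v\<close>
  and \<open>u\<close> that vanish at \<open>-\<infinity>\<close>. In these variables the boundary condition is \<open>U'(0) = - s(0) V(0)\<close>,
  and with \<open>\<zeta> = w - b\<close> the equations are
  \<open>V' = u - \<lambda> V\<close>, \<open>U' = u\<close>, \<open>u' = b u + \<lambda> (w U + \<zeta> V)\<close>.
  At zero amplitude \<open>w = \<zeta> = 1\<close> and \<open>b = 0\<close>; the difference \<open>D = V - U\<close>, which obeys \<open>D' = - \<lambda> V\<close>, is then
  carried to the right at unit order speed, whereas \<open>U + V\<close> obeys a slow viscous Burgers-like
  equation.

  Three facts settle the matter, all of them uniform in the position of the wall.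

  First, the functional \<open>(Re (u U\<^sup>*) - b \<bar>U\<bar>\<^sup>2 / 2) / \<zeta> - \<bar>D\<bar>\<^sup>2 / 2\<close> vanishes at \<open>-\<infinity>\<close> and is nondecreasing when
  \<open>Re \<lambda> \<ge> 0\<close>, since the \<open>b' \<bar>U\<bar>\<^sup>2\<close> term produced by the compressive profile has the good sign. Hence
  \<open>Re (u / U) \<ge> b / 2 + \<zeta> \<bar>D / U\<bar>\<^sup>2 / 2\<close> at every point (lemma \<open>coercive\<close>).

  Second, at the wall the boundary condition makes \<open>Re (u U\<^sup>*)\<close> almost nonpositive, so the functional, and
  with it all the dissipation, is tiny there. Then \<open>U\<close> is almost constant near the wall while \<open>D\<close> is
  small, and \<open>D' = - \<lambda> (U + D)\<close> forces \<open>\<bar>\<lambda>\<bar>\<close> to be small (lemma \<open>small_frequency\<close>).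

  Third, for small \<open>\<bar>\<lambda>\<bar>\<close> the ratios \<open>d = D / U\<close> and \<open>P = u / U\<close> are followed backwards from the wall. If
  \<open>\<bar>d\<bar>\<close> ever exceeded \<open>1/2\<close>, the lower bound on \<open>Re P\<close> would make \<open>\<bar>d\<bar>\<close> blow up at finite distance on the left
  (lemma \<open>ratio_small\<close>). Finally \<open>P\<close> solves the Riccati equation
  \<open>P' = b P - P\<^sup>2 + \<lambda> (w + \<zeta> + \<zeta> d)\<close>, whose forcing differs in argument from \<open>\<lambda>\<close> by less
  than \<open>\<pi> / 4\<close>. The half-plane \<open>Re P \<plusminus> Im P \<ge> 0\<close>, with the sign of \<open>Im \<lambda>\<close>, is therefore forward
  invariant, and outside it \<open>- s (Re P \<plusminus> Im P)\<close> blows up backwards in the same way. The boundary condition puts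
  \<open>P(0)\<close> outside. So there is no nontrivial mode.

  The weight \<open>s\<close> in the last step is what makes the argument insensitive to how close \<open>v0\<close> is to \<open>vp\<close>: there
  \<open>b\<close> is negative, and the boundary term \<open>- b \<bar>U\<bar>\<^sup>2 / 2\<close> spoils the sign of the unweighted energy at the wall.
\<close>

section \<open>Tools from real analysis\<close>

text \<open>A quantity that decreases at least as fast as a solution of \<open>N' = - k N\<^sup>2\<close> would have to be infinite at a
  finite distance to the left. The threshold \<open>c\<close> permits the differential inequality to be checked only
  where the quantity is large; above the threshold it can only grow to the left, so it stays there.\<close>
lemma no_backward_quadratic_decay:
  fixes N N' :: "real \<Rightarrow> real"
  assumes c: "0 \<le> c" and k: "0 < k" and start: "c < N x1"
    and cont: "continuous_on {..x1} N"
    and der: "\<And>x. x < x1 \<Longrightarrow> (N has_real_derivative N' x) (at x)"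
    and decay: "\<And>x. x < x1 \<Longrightarrow> c < N x \<Longrightarrow> N' x \<le> - k * (N x)\<^sup>2"
  shows False
proof -
  have above: "c < N x0" if x0: "x0 \<le> x1" for x0
  proof (rule ccontr)
    assume neg: "\<not> c < N x0"
    define S where "S = {x \<in> {x0..x1}. N x \<le> c}"
    have cont': "continuous_on {x0..x1} N"
      by (rule continuous_on_subset[OF cont]) auto
    have "closed S"
      unfolding S_def by (intro continuous_on_closed_Collect_le cont' continuous_intros)
    then have "compact S"
      unfolding compact_eq_bounded_closed
      by (auto simp: S_def intro!: boundedI[of _ "\<bar>x0\<bar> + \<bar>x1\<bar>"])
    moreover have "x0 \<in> S" using neg x0 by (auto simp: S_def)
    ultimately obtain t where t: "t \<in> S" "\<And>x. x \<in> S \<Longrightarrow> x \<le> t"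
      by (metis compact_attains_sup empty_iff)
    have "N x1 \<le> N t"
    proof (rule DERIV_nonpos_imp_decreasing_open[of t x1 N])
      show "t \<le> x1" using t(1) by (auto simp: S_def)
      show "continuous_on {t..x1} N" by (rule continuous_on_subset[OF cont]) auto
      fix x assume x: "t < x" "x < x1"
      then have "x \<notin> S" using t(2) by force
      then have "c < N x" using x t(1) by (auto simp: S_def)
      with decay x have "N' x \<le> - k * (N x)\<^sup>2" by blast
      also have "\<dots> \<le> 0" using k by simp
      finally show "\<exists>y. (N has_real_derivative y) (at x) \<and> y \<le> 0" using der x by blast
    qed
    then show False using t(1) start by (auto simp: S_def)
  qed
  define x0 where "x0 = x1 - 1 / (k * N x1) - 1"
  have pos: "0 < N x" if "x \<le> x1" for x using above[OF that] c by linarith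
  have "0 < 1 / (k * N x1)" using k pos[of x1] by simp
  then have x0: "x0 \<le> x1" unfolding x0_def by linarith
  have "1 / N x0 - k * x0 \<le> 1 / N x1 - k * x1"
  proof (rule DERIV_nonneg_imp_increasing_open[of x0 x1 "\<lambda>x. 1 / N x - k * x"])
    show "x0 \<le> x1" by (fact x0)
    show "continuous_on {x0..x1} (\<lambda>x. 1 / N x - k * x)"
      using pos by (intro continuous_intros continuous_on_subset[OF cont]) force+
    fix x assume x: "x0 < x" "x < x1"
    have n: "0 < N x" using pos x by simp
    have "((\<lambda>x. 1 / N x - k * x) has_real_derivative (- N' x / (N x)\<^sup>2 - k)) (at x)"
      using n by (auto intro!: derivative_eq_intros der x simp: power2_eq_square)
    moreover have "N' x \<le> - k * (N x)\<^sup>2" using decay above x by simp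
    then have "0 \<le> - N' x / (N x)\<^sup>2 - k" using n by (simp add: field_simps)
    ultimately show "\<exists>y. ((\<lambda>x. 1 / N x - k * x) has_real_derivative y) (at x) \<and> 0 \<le> y" by blast
  qed
  moreover have "k * (x1 - x0) = 1 / N x1 + k"
    using k pos[of x1] by (simp add: x0_def field_simps)
  ultimately have "1 / N x0 \<le> - k" by (simp add: algebra_simps)
  then show False using k pos[OF x0] by (smt (verit) divide_pos_pos)
qed

lemma has_real_derivative_inner:
  fixes f g :: "real \<Rightarrow> 'a::real_inner"
  assumes "(f has_vector_derivative f') (at x)" "(g has_vector_derivative g') (at x)"
  shows "((\<lambda>x. f x \<bullet> g x) has_real_derivative (f x \<bullet> g' + f' \<bullet> g x)) (at x)"
  using bounded_bilinear.has_vector_derivative[OF bounded_bilinear_inner assms]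
  by (simp add: has_real_derivative_iff_has_vector_derivative)

lemma has_vector_derivative_complex_divide:
  fixes f g :: "real \<Rightarrow> complex"
  assumes "(f has_vector_derivative f') (at x)" "(g has_vector_derivative g') (at x)" "g x \<noteq> 0"
  shows "((\<lambda>x. f x / g x) has_vector_derivative (f' / g x - f x / g x * (g' / g x))) (at x)"
proof -
  have "(inverse has_field_derivative - (inverse (g x) ^ Suc (Suc 0))) (at (g x))"
    using DERIV_inverse[OF assms(3)] .
  from field_vector_diff_chain_at[OF assms(2) this]
  have "((\<lambda>x. inverse (g x)) has_vector_derivative (g' * - (inverse (g x) ^ Suc (Suc 0)))) (at x)"
    by (simp add: o_def)
  from has_vector_derivative_mult[OF assms(1) this] show ?thesis
    using assms(3) by (simp add: field_simps)
qed

text \<open>The primitive \<open>U\<close> involves \<open>u'\<close>, which need not exist at the wall; it nevertheless has a boundary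
  value because its derivative \<open>u\<close> is continuous up to the wall.\<close>
lemma extends_continuously:
  fixes U u :: "real \<Rightarrow> complex"
  assumes dU: "\<And>x. x < 0 \<Longrightarrow> (U has_vector_derivative u x) (at x)"
    and u: "continuous_on {..0} u"
  obtains L where "continuous_on {..0} (\<lambda>x. if x < 0 then U x else L)"
proof -
  define g where "g x = integral {-1..x} u" for x
  have dg: "(g has_vector_derivative u x) (at x within {-1..0})" if "x \<in> {-1..0}" for x
    unfolding g_def by (rule integral_has_vector_derivative[OF continuous_on_subset[OF u] that]) auto
  obtain c where "\<And>x. x \<in> {-1<..<0} \<Longrightarrow> U x - g x = c"
  proof (rule has_vector_derivative_zero_constant[of "{-1<..<0}" "\<lambda>x. U x - g x"])
    fix x :: real assume x: "x \<in> {-1<..<0}"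
    have "(g has_vector_derivative u x) (at x within {-1<..<0})"
      by (rule has_vector_derivative_within_subset[OF dg]) (use x in auto)
    then show "((\<lambda>x. U x - g x) has_vector_derivative 0) (at x within {-1<..<0})"
      using has_vector_derivative_diff[OF has_vector_derivative_at_within[OF dU]] x by fastforce
  qed auto
  then have c: "U x = g x + c" if "-1 < x" "x < 0" for x using that by (simp add: diff_eq_eq add.commute)
  define f where "f x = (if x < 0 then U x else g 0 + c)" for x
  have "continuous_on {-1/2..0} f"
  proof (rule continuous_on_eq)
    show "continuous_on {-1/2..0} (\<lambda>x. g x + c)"
      by (intro continuous_intros continuous_on_subset[OF continuous_on_vector_derivative[OF dg]]) auto
  qed (auto simp: f_def c)
  moreover have "continuous_on {..-1/2} f"
  proof (rule continuous_on_eq)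
    show "continuous_on {..-1/2} U"
      by (auto intro!: continuous_at_imp_continuous_on has_vector_derivative_continuous dU)
  qed (auto simp: f_def)
  ultimately have "continuous_on ({..-1/2} \<union> {-1/2..0}) f" by (intro continuous_on_closed_Un) auto
  moreover have "{..-1/2} \<union> {-1/2..0::real} = {..0}" by auto
  ultimately show ?thesis using that[of "g 0 + c"] unfolding f_def by simp
qed

section \<open>The integrated eigenvalue problem\<close>

text \<open>The decay of \<open>U\<close> at \<open>-\<infinity>\<close> is not part of the hypotheses on \<open>(v, u)\<close>. It follows from the argument of
  Barbalat: far to the left \<open>U\<close> hardly changes over a unit interval, so \<open>u' \<approx> \<lambda> w U(x)\<close> there, and the
  increment of \<open>u\<close>, which is small, is about \<open>\<lambda> U(x)\<close>.\<close>
lemma integrated_velocity_tendsto_zero: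
  fixes U V u :: "real \<Rightarrow> complex" and w b :: "real \<Rightarrow> real"
  assumes lam: "lam \<noteq> 0"
    and dU: "\<And>x. x < 0 \<Longrightarrow> (U has_vector_derivative u x) (at x)"
    and du: "\<And>x. x < 0 \<Longrightarrow> (u has_vector_derivative
        (of_real (b x) * u x + lam * (of_real (w x) * U x + of_real (w x - b x) * V x))) (at x)"
    and b: "\<And>x. \<bar>b x\<bar> \<le> 1 / 10"
    and w: "\<And>x. 9 / 10 \<le> w x" "\<And>x. w x \<le> 1"
    and lim: "(V \<longlongrightarrow> 0) at_bot" "(u \<longlongrightarrow> 0) at_bot"
  shows "(U \<longlongrightarrow> 0) at_bot"
proof (rule tendstoI)
  fix e :: real assume e: "0 < e"
  define l where "l = norm lam"
  have l: "0 < l" using lam by (simp add: l_def)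
  define \<delta> where "\<delta> = e * l / (6 + 6 * l)"
  have \<delta>: "0 < \<delta>" using e l by (simp add: \<delta>_def)
  have "\<forall>\<^sub>F x in at_bot. norm (V x) < \<delta> \<and> norm (u x) < \<delta>"
    using tendstoD[OF lim(1) \<delta>] tendstoD[OF lim(2) \<delta>] by eventually_elim simp
  then obtain X where X: "\<And>x. x \<le> X \<Longrightarrow> norm (V x) < \<delta> \<and> norm (u x) < \<delta>"
    by (auto simp: eventually_at_bot_linorder)
  have "norm (U x) < e" if x: "x \<le> min X (-1)" for x
  proof -
    define K where "K = \<delta> + l * (norm (U x) / 10 + 7/2 * \<delta>)"
    have close: "norm (U x - U t) \<le> \<delta>" if t: "x - 1 < t" "t < x" for t
    proof -
      have "norm (U x - U t) \<le> \<delta> * x - \<delta> * t"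
      proof (rule differentiable_bound_general[of t x U "\<lambda>t. \<delta> * t" u "\<lambda>_. \<delta>"])
        show "continuous_on {t..x} U"
          using x by (auto intro!: continuous_at_imp_continuous_on has_vector_derivative_continuous dU)
      qed (use t x X dU in \<open>auto intro!: continuous_intros derivative_eq_intros less_imp_le
            simp: has_real_derivative_iff_has_vector_derivative[symmetric]\<close>)
      also have "\<dots> = \<delta> * (x - t)" by (simp add: algebra_simps)
      also have "\<dots> \<le> \<delta> * 1" using t \<delta> by (intro mult_left_mono) auto
      finally show ?thesis by simp
    qed
    have "norm ((u x - of_real x * (lam * U x)) - (u (x - 1) - of_real (x - 1) * (lam * U x))) \<le> K * x - K * (x - 1)"
    proof (rule differentiable_bound_general[where f = "\<lambda>t. u t - of_real t * (lam * U x)" and \<phi> = "\<lambda>t. K * t"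
        and \<phi>' = "\<lambda>_. K" and f' = "\<lambda>t. of_real (b t) * u t + lam * (of_real (w t) * U t + of_real (w t - b t) * V t) - lam * U x"])
      show "continuous_on {x - 1..x} (\<lambda>t. u t - of_real t * (lam * U x))"
        using x by (intro continuous_intros continuous_at_imp_continuous_on ballI has_vector_derivative_continuous[OF du]) auto
      fix t assume t: "x - 1 < t" "t < x"
      have t0: "t < 0" "t \<le> X" using t x by auto
      show "((\<lambda>t. u t - of_real t * (lam * U x)) has_vector_derivative
         of_real (b t) * u t + lam * (of_real (w t) * U t + of_real (w t - b t) * V t) - lam * U x) (at t)"
        by (rule has_vector_derivative_eq_rhs[OF has_vector_derivative_diff[OF du[OF t0(1)]
              has_vector_derivative_mult_left[OF has_vector_derivative_of_real[OF DERIV_ident]]]]) simp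
      have "of_real (b t) * u t + lam * (of_real (w t) * U t + of_real (w t - b t) * V t) - lam * U x
          = of_real (b t) * u t + lam * (of_real (w t - b t) * V t - of_real (w t) * (U x - U t) - of_real (1 - w t) * U x)"
        by (simp add: algebra_simps)
      also have "norm \<dots> \<le> norm (of_real (b t) * u t) + l * norm (of_real (w t - b t) * V t
            - of_real (w t) * (U x - U t) - of_real (1 - w t) * U x)"
        unfolding l_def norm_mult[symmetric] by (rule norm_triangle_ineq)
      also have "norm (of_real (w t - b t) * V t - of_real (w t) * (U x - U t) - of_real (1 - w t) * U x)
          \<le> norm (of_real (w t - b t) * V t - of_real (w t) * (U x - U t)) + norm (of_real (1 - w t) * U x)"
        by (rule norm_triangle_ineq4)
      also have "norm (of_real (w t - b t) * V t - of_real (w t) * (U x - U t))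
          \<le> norm (of_real (w t - b t) * V t) + norm (of_real (w t) * (U x - U t))"
        by (rule norm_triangle_ineq4)
      finally have "norm (of_real (b t) * u t + lam * (of_real (w t) * U t + of_real (w t - b t) * V t) - lam * U x)
          \<le> norm (of_real (b t) * u t) + l * (norm (of_real (w t - b t) * V t)
            + norm (of_real (w t) * (U x - U t)) + norm (of_real (1 - w t) * U x))"
        using l by (simp add: mult_left_mono)
      also have "\<dots> \<le> 1 * \<delta> + l * (2 * \<delta> + 1 * \<delta> + 1/10 * norm (U x))"
        unfolding norm_mult norm_of_real using X[OF t0(2)] b[of t] w[of t] \<delta> l close[OF t]
        by (intro add_mono mult_mono mult_left_mono) auto
      also have "\<dots> \<le> K" using l \<delta> by (simp add: K_def algebra_simps)
      finally show "norm (of_real (b t) * u t + lam * (of_real (w t) * U t + of_real (w t - b t) * V t) - lam * U x) \<le> K" .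
    qed (auto intro!: continuous_intros derivative_eq_intros
            simp: has_real_derivative_iff_has_vector_derivative[symmetric])
    moreover have "(u x - of_real x * (lam * U x)) - (u (x - 1) - of_real (x - 1) * (lam * U x)) = u x - u (x - 1) - lam * U x"
      by (simp add: algebra_simps)
    ultimately have "norm (u x - u (x - 1) - lam * U x) \<le> K" by (simp add: algebra_simps)
    moreover have "norm (lam * U x) \<le> norm (u x - u (x - 1) - lam * U x) + (norm (u x) + norm (u (x - 1)))"
      by (smt (verit) norm_triangle_ineq4 norm_minus_commute norm_triangle_sub)
    ultimately have "l * norm (U x) \<le> K + 2 * \<delta>"
      using X[of x] X[of "x - 1"] x by (simp add: norm_mult l_def)
    then have "l * norm (U x) * (9/10) \<le> \<delta> * (3 + 7/2 * l)"
      unfolding K_def by (simp add: algebra_simps)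
    also have "\<dots> < \<delta> * ((6 + 6 * l) * (9/10))" using \<delta> l by (intro mult_strict_left_mono) auto
    also have "\<dots> = e * l * (9/10)" using l by (simp add: \<delta>_def field_simps)
    finally show "norm (U x) < e" using l by simp
  qed
  then show "\<forall>\<^sub>F x in at_bot. dist (U x) 0 < e"
    unfolding eventually_at_bot_linorder by (intro exI[of _ "min X (-1)"]) auto
qed

text \<open>The amplitude bound: a fourth power, because the estimates lose a square root twice (from the energy to
  \<open>U\<close>, and from \<open>U\<close> to \<open>D\<close>).\<close>
definition \<beta> :: real where "\<beta> = (1 / 10000) ^ 4"

lemma \<beta>_small: "0 < \<beta>" "\<beta> \<le> 1 / 10 ^ 16"
  by (simp_all add: \<beta>_def power4_eq_xxxx)

text \<open>The data of an integrated mode: the profile \<open>w\<close> with its slope \<open>- s\<close>, the coefficients \<open>b\<close> and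
  \<open>B = db/dw\<close>, and the smallness that holds for weak layers. The wall is at \<open>0\<close>; the profile may be
  translated arbitrarily, so all bounds are uniform in \<open>v0\<close>.\<close>
locale integrated_mode =
  fixes lam :: complex and U V u :: "real \<Rightarrow> complex" and w s b B :: "real \<Rightarrow> real"
  assumes lam: "lam \<noteq> 0" "0 \<le> Re lam"
    and cont: "continuous_on {..0} U" "continuous_on {..0} V" "continuous_on {..0} u"
    and dU: "\<And>x. x < 0 \<Longrightarrow> (U has_vector_derivative u x) (at x)"
    and dV: "\<And>x. x < 0 \<Longrightarrow> (V has_vector_derivative (u x - lam * V x)) (at x)"
    and du: "\<And>x. x < 0 \<Longrightarrow> (u has_vector_derivative
        (of_real (b x) * u x + lam * (of_real (w x) * U x + of_real (w x - b x) * V x))) (at x)"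
    and dw: "\<And>x. (w has_real_derivative - s x) (at x)"
    and ds: "\<And>x. (s has_real_derivative b x * s x) (at x)"
    and db: "\<And>x. (b has_real_derivative - B x * s x) (at x)"
    and s: "\<And>x. 0 < s x" "\<And>x. s x \<le> \<beta>"
    and b: "\<And>x. \<bar>b x\<bar> \<le> \<beta>"
    and B: "\<And>x. 1 \<le> B x" "\<And>x. B x * s x \<le> 1 / 10"
    and w: "\<And>x. 9 / 10 \<le> w x" "\<And>x. w x \<le> 1"
    and lim: "(U \<longlongrightarrow> 0) at_bot" "(V \<longlongrightarrow> 0) at_bot" "(u \<longlongrightarrow> 0) at_bot"
    and bc: "u 0 = - of_real (s 0) * V 0"
begin

abbreviation z where "z x \<equiv> w x - b x"
abbreviation D where "D x \<equiv> V x - U x"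

lemma z_bounds: "7 / 8 \<le> z x" "z x \<le> 9 / 8" "0 < z x"
  using w[of x] b[of x] \<beta>_small by auto

lemma deriv_D: "x < 0 \<Longrightarrow> (D has_vector_derivative - (lam * V x)) (at x)"
  using has_vector_derivative_diff[OF dV dU, of x] by simp

lemma cont_D: "continuous_on {..0} D"
  by (intro continuous_intros cont)

lemma cont_coeff: "continuous_on S w" "continuous_on S s" "continuous_on S b"
  using DERIV_isCont[OF dw] DERIV_isCont[OF ds] DERIV_isCont[OF db]
  by (auto intro!: continuous_at_imp_continuous_on)

text \<open>The factor \<open>1 / z\<close> is chosen so that the \<open>D\<close> terms in the derivative of the first summand cancel the
  derivative of \<open>- \<bar>D\<bar>\<^sup>2 / 2\<close> exactly; otherwise the undamped fast component would leave a term of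
  indefinite sign.\<close>
definition F where
  "F x = (u x \<bullet> U x - b x / 2 * (U x \<bullet> U x)) / z x - (D x \<bullet> D x) / 2"

lemma cont_F: "continuous_on {..0} F"
  unfolding F_def using z_bounds by (intro continuous_intros cont cont_coeff) (auto simp: less_imp_neq[symmetric])

text \<open>The only term of the wrong sign comes from \<open>z'\<close> and is of the order of \<open>B s\<close> times \<open>\<bar>u\<bar> \<bar>U\<bar>\<close>. Since
  \<open>s\<close> is small, it is absorbed by \<open>\<bar>u\<bar>\<^sup>2\<close> and by the term \<open>B s \<bar>U\<bar>\<^sup>2 / 2\<close> that the monotonicity of the
  profile provides.\<close>
lemma F_dissipation:
  assumes x: "x < 0"
  shows "\<exists>F'. (F has_real_derivative F') (at x) \<and> u x \<bullet> u x \<le> 3 * F'"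
proof -
  define R where "R = u x \<bullet> U x"
  define N where "N = U x \<bullet> U x"
  define Q where "Q = u x \<bullet> u x"
  define n where "n = Re lam * (w x * N + z x * (V x \<bullet> V x))"
  define F' where "F' = (Q + n + B x * s x / 2 * N - (B x - 1) * s x / z x * (R - b x / 2 * N)) / z x"
  have dR: "((\<lambda>x. u x \<bullet> U x) has_real_derivative
     (Q + (of_real (b x) * u x + lam * (of_real (w x) * U x + of_real (z x) * V x)) \<bullet> U x)) (at x)"
    using has_real_derivative_inner[OF du[OF x] dU[OF x]] unfolding Q_def by simp
  have dN: "((\<lambda>x. U x \<bullet> U x) has_real_derivative 2 * R) (at x)"
    using has_real_derivative_inner[OF dU[OF x] dU[OF x]] by (simp add: R_def inner_commute)
  have dDD: "((\<lambda>x. D x \<bullet> D x) has_real_derivative (- 2 * ((lam * V x) \<bullet> D x))) (at x)"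
    using has_real_derivative_inner[OF deriv_D[OF x] deriv_D[OF x]] by (simp add: inner_commute)
  have dz: "(z has_real_derivative (B x - 1) * s x) (at x)"
    using DERIV_diff[OF dw db, of x] by (simp add: algebra_simps)
  \<comment> \<open>Uses \<open>Re (\<lambda> V U\<^sup>*) = Re \<lambda> \<bar>V\<bar>\<^sup>2 - Re (\<lambda> V D\<^sup>*)\<close>, where \<open>\<lambda> V = - D'\<close>.\<close>
  have eqR: "Q + (of_real (b x) * u x + lam * (of_real (w x) * U x + of_real (z x) * V x)) \<bullet> U x
     = Q + b x * R + n - z x * ((lam * V x) \<bullet> D x)"
    unfolding n_def N_def R_def
    by (simp add: inner_complex_def algebra_simps)
  have "(F has_real_derivative F') (at x)"
    unfolding F_def
  proof (rule DERIV_cong[OF DERIV_diff[OF DERIV_divide[OF DERIV_diff[OF dR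
            DERIV_mult[OF DERIV_cdivide[OF db, of 2] dN]] dz] DERIV_cdivide[OF dDD, of 2]]])
    show "z x \<noteq> 0" using z_bounds(3)[of x] by simp
    then show "((Q + (of_real (b x) * u x + lam * (of_real (w x) * U x + of_real (z x) * V x)) \<bullet> U x
        - (- B x * s x / 2 * (U x \<bullet> U x) + 2 * R * (b x / 2))) * z x
        - (u x \<bullet> U x - b x / 2 * (U x \<bullet> U x)) * ((B x - 1) * s x)) / (z x * z x)
        - - 2 * ((lam * V x) \<bullet> D x) / 2 = F'"
      unfolding eqR N_def[symmetric] R_def[symmetric] F'_def
      by (simp add: divide_simps) (simp add: algebra_simps)
  qed
  moreover have "Q \<le> 3 * F'"
  proof -
    have N0: "0 \<le> N" "0 \<le> Q" by (simp_all add: N_def Q_def)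
    have n0: "0 \<le> n" unfolding n_def using lam(2) w[of x] z_bounds[of x] by (auto simp: N_def)
    define k where "k = (B x - 1) * s x / z x"
    have k0: "0 \<le> k" unfolding k_def using B[of x] s[of x] z_bounds[of x] by simp
    have "k \<le> B x * s x / (7/8)" unfolding k_def using B[of x] s[of x] z_bounds[of x]
      by (intro frac_le mult_mono) auto
    then have k1: "k \<le> 8/7 * (B x * s x)" by simp
    have Bs0: "0 \<le> B x * s x" using B(1)[of x] s(1)[of x] by simp
    have Bs: "B x * s x \<le> 1 / 10" by (fact B(2))
    have "2 * (k * R) \<le> Q + k * k * N"
    proof -
      have "0 \<le> (u x - k *\<^sub>R U x) \<bullet> (u x - k *\<^sub>R U x)" by simp
      also have "\<dots> = Q - 2 * (k * R) + k * k * N"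
        by (simp add: Q_def N_def R_def inner_diff_left inner_diff_right inner_commute)
      finally show ?thesis by simp
    qed
    moreover have "k * k * N \<le> (1/4 * (B x * s x)) * N"
    proof (rule mult_right_mono[OF _ N0(1)])
      have "k * k \<le> k * (1/5)" using k0 k1 Bs by (intro mult_left_mono) auto
      also have "\<dots> \<le> 8/7 * (B x * s x) * (1/5)" using k1 by (intro mult_right_mono) auto
      also have "\<dots> \<le> 1/4 * (B x * s x)" using B(1)[of x] s(1)[of x] by simp
      finally show "k * k \<le> 1/4 * (B x * s x)" .
    qed
    moreover have "- (k * (b x / 2 * N)) \<le> (1/4 * (B x * s x)) * N"
    proof -
      have "- (k * (b x / 2 * N)) = (k * (- b x / 2)) * N" by simp
      also have "\<dots> \<le> (k * (1/8)) * N"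
        using b[of x] \<beta>_small by (intro mult_right_mono mult_left_mono k0 N0) auto
      also have "\<dots> \<le> (1/4 * (B x * s x)) * N"
        using k1 Bs0 by (intro mult_right_mono N0) linarith
      finally show ?thesis .
    qed
    moreover have "0 \<le> B x * s x * N" using Bs0 N0 by simp
    ultimately have "Q / 2 \<le> Q + n + B x * s x / 2 * N - k * (R - b x / 2 * N)"
      using n0 by (simp add: algebra_simps)
    then have "Q / 2 / z x \<le> F'" unfolding F'_def k_def[symmetric] using z_bounds[of x]
      by (intro divide_right_mono) auto
    moreover have "Q / 3 \<le> Q / 2 / z x" using N0 divide_left_mono[of "z x" "3/2" "Q/2"] z_bounds[of x] by simp
    ultimately show ?thesis by linarith
  qed
  ultimately show ?thesis unfolding Q_def by blast
qed

lemma F_mono: "x \<le> y \<Longrightarrow> y \<le> 0 \<Longrightarrow> F x \<le> F y"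
proof (rule DERIV_nonneg_imp_increasing_open[of x y F])
  assume "x \<le> y" "y \<le> 0"
  then show "continuous_on {x..y} F" by (intro continuous_on_subset[OF cont_F]) auto
  fix t assume "x < t" "t < y"
  then obtain F' where "(F has_real_derivative F') (at t)" "u t \<bullet> u t \<le> 3 * F'"
    using F_dissipation[of t] \<open>y \<le> 0\<close> by auto
  moreover have "0 \<le> u t \<bullet> u t" by simp
  ultimately show "\<exists>y. (F has_real_derivative y) (at t) \<and> 0 \<le> y"
    by (intro exI[of _ F'] conjI) linarith+
qed

lemma F_tendsto: "(F \<longlongrightarrow> 0) at_bot"
proof -
  have "((\<lambda>x. \<bar>u x \<bullet> U x\<bar> + U x \<bullet> U x) \<longlongrightarrow> \<bar>0 \<bullet> (0::complex)\<bar> + 0 \<bullet> (0::complex)) at_bot"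
    by (intro tendsto_intros lim)
  then have "((\<lambda>x. 2 * (\<bar>u x \<bullet> U x\<bar> + U x \<bullet> U x)) \<longlongrightarrow> 0) at_bot"
    using tendsto_mult_left[of "\<lambda>x. \<bar>u x \<bullet> U x\<bar> + U x \<bullet> U x" 0 at_bot 2] by simp
  then have "((\<lambda>x. (u x \<bullet> U x - b x / 2 * (U x \<bullet> U x)) / z x) \<longlongrightarrow> 0) at_bot"
  proof (rule Lim_null_comparison[rotated], intro always_eventually allI)
    fix x
    have "\<bar>u x \<bullet> U x - b x / 2 * (U x \<bullet> U x)\<bar> \<le> \<bar>u x \<bullet> U x\<bar> + \<bar>b x / 2\<bar> * (U x \<bullet> U x)"
      using abs_triangle_ineq4[of "u x \<bullet> U x" "b x / 2 * (U x \<bullet> U x)"] by (simp add: abs_mult)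
    also have "\<dots> \<le> \<bar>u x \<bullet> U x\<bar> + 1 * (U x \<bullet> U x)"
      using b[of x] \<beta>_small by (intro add_left_mono mult_right_mono) auto
    finally have *: "\<bar>u x \<bullet> U x - b x / 2 * (U x \<bullet> U x)\<bar> \<le> \<bar>u x \<bullet> U x\<bar> + U x \<bullet> U x" by simp
    have "norm ((u x \<bullet> U x - b x / 2 * (U x \<bullet> U x)) / z x) \<le> (\<bar>u x \<bullet> U x\<bar> + U x \<bullet> U x) / (1/2)"
      unfolding real_norm_def abs_divide using * z_bounds[of x] by (intro frac_le) auto
    then show "norm ((u x \<bullet> U x - b x / 2 * (U x \<bullet> U x)) / z x) \<le> 2 * (\<bar>u x \<bullet> U x\<bar> + U x \<bullet> U x)"
      by simp
  qed
  moreover have "((\<lambda>x. (D x \<bullet> D x) / 2) \<longlongrightarrow> ((0 - 0) \<bullet> (0 - 0 :: complex)) / 2) at_bot"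
    by (intro tendsto_intros lim) auto
  ultimately show ?thesis unfolding F_def using tendsto_diff by fastforce
qed

lemma F_nonneg: assumes "x \<le> 0" shows "0 \<le> F x"
proof (rule tendsto_upperbound[OF F_tendsto])
  show "\<forall>\<^sub>F i in at_bot. F i \<le> F x"
    using eventually_le_at_bot[of x] by eventually_elim (use assms F_mono in auto)
qed simp

lemma coercive:
  assumes "x \<le> 0"
  shows "b x / 2 * (U x \<bullet> U x) + z x / 2 * (D x \<bullet> D x) \<le> u x \<bullet> U x"
  using F_nonneg[OF assms] z_bounds(3)[of x] unfolding F_def by (simp add: field_simps)

text \<open>If \<open>U\<close> vanishes at a point, then \<open>F \<le> 0\<close> there, so \<open>F\<close> vanishes identically to the left, and with it the
  dissipation \<open>\<bar>u\<bar>\<^sup>2\<close>.\<close>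
lemma vanishing_before:
  assumes x1: "x1 \<le> 0" "U x1 = 0" and x: "x < x1"
  shows "U x = 0" "V x = 0" "u x = 0"
proof -
  have F1: "F x1 \<le> 0" using x1 unfolding F_def by simp
  have F0: "F y = 0" if "y \<le> x1" for y
    using F_nonneg[of y] F_mono[of y x1] F1 that x1 by auto
  have u0: "u y = 0" if y: "y < x1" for y
  proof -
    obtain F' where F': "(F has_real_derivative F') (at y)" "u y \<bullet> u y \<le> 3 * F'"
      using F_dissipation[of y] y x1 by auto
    have "(F has_real_derivative 0) (at y)"
      by (rule has_field_derivative_transform_within_open[of "\<lambda>_. 0" _ _ "{..<x1}"])
         (use y F0 in auto)
    then have "F' = 0" using F'(1) DERIV_unique by blast
    then have "norm (u y) ^ 2 \<le> 0" using F'(2) by (simp add: power2_norm_eq_inner)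
    then show ?thesis by simp
  qed
  have U0: "U y = 0" if y: "y < x1" for y
  proof -
    obtain c where c: "\<And>t. t \<in> {..<x1} \<Longrightarrow> U t = c"
    proof (rule has_vector_derivative_zero_constant[of "{..<x1}" U])
      fix t assume "t \<in> {..<x1}"
      then show "(U has_vector_derivative 0) (at t within {..<x1})"
        using dU[of t] u0[of t] x1 by (auto intro: has_vector_derivative_at_within)
    qed auto
    have "(U \<longlongrightarrow> c) at_bot"
    proof (rule tendsto_eventually)
      show "\<forall>\<^sub>F t in at_bot. U t = c"
        using eventually_gt_at_bot[of x1] by eventually_elim (simp add: c)
    qed
    then have "c = 0" using tendsto_unique[OF trivial_limit_at_bot_linorder _ lim(1)] by blast
    then show ?thesis using c y by simp
  qed
  have "D x \<bullet> D x = 0" using F0[of x] x U0[of x] unfolding F_def by simp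
  then show "U x = 0" "V x = 0" "u x = 0" using U0 u0 x by auto
qed

text \<open>To the right of the zero of \<open>U\<close> the mode vanishes by uniqueness for the linear system, obtained here from
  a Gronwall estimate for \<open>\<bar>U\<bar>\<^sup>2 + \<bar>V\<bar>\<^sup>2 + \<bar>u\<bar>\<^sup>2\<close>.\<close>
lemma vanishing:
  assumes x1: "x1 \<le> 0" "U x1 = 0" and x: "x \<le> 0"
  shows "U x = 0 \<and> V x = 0 \<and> u x = 0"
proof -
  have at: "f x1 = 0" if "continuous_on {..0} f" "\<And>y. y < x1 \<Longrightarrow> f y = 0" for f :: "real \<Rightarrow> complex"
    by (rule continuous_constant_on_closure[of "{..<x1}"])
       (use that x1 in \<open>auto intro: continuous_on_subset\<close>)
  have at1: "U x1 = 0" "V x1 = 0" "u x1 = 0"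
    using at cont vanishing_before[OF x1] by auto
  show ?thesis
  proof (cases "x < x1")
    case True
    then show ?thesis using vanishing_before[OF x1] by simp
  next
    case False
    define N where "N t = U t \<bullet> U t + V t \<bullet> V t + u t \<bullet> u t" for t
    define C where "C = 4 + 4 * norm lam"
    have "N x * exp (- C * x) \<le> N x1 * exp (- C * x1)"
    proof (rule DERIV_nonpos_imp_decreasing_open[of x1 x "\<lambda>t. N t * exp (- C * t)"])
      show "x1 \<le> x" using False by simp
      show "continuous_on {x1..x} (\<lambda>t. N t * exp (- C * t))" unfolding N_def
        using x by (intro continuous_intros continuous_on_subset[OF cont(1)]
            continuous_on_subset[OF cont(2)] continuous_on_subset[OF cont(3)]) auto
      fix t assume t: "x1 < t" "t < x"
      then have t0: "t < 0" using x by simp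
      define a where "a = norm (U t)"
      define v where "v = norm (V t)"
      define y where "y = norm (u t)"
      define l where "l = norm lam"
      define u' where "u' = of_real (b t) * u t + lam * (of_real (w t) * U t + of_real (z t) * V t)"
      define N' where "N' = 2 * (u t \<bullet> U t) + 2 * ((u t - lam * V t) \<bullet> V t) + 2 * (u' \<bullet> u t)"
      have dN: "(N has_real_derivative N') (at t)"
        unfolding N_def N'_def u'_def
        by (rule DERIV_cong[OF DERIV_add[OF DERIV_add[OF has_real_derivative_inner[OF dU[OF t0] dU[OF t0]]
              has_real_derivative_inner[OF dV[OF t0] dV[OF t0]]] has_real_derivative_inner[OF du[OF t0] du[OF t0]]]])
           (simp add: inner_commute)
      have nn: "0 \<le> a" "0 \<le> v" "0 \<le> y" "0 \<le> l" by (simp_all add: a_def v_def y_def l_def)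
      have Nt: "N t = a\<^sup>2 + v\<^sup>2 + y\<^sup>2" by (simp add: N_def a_def v_def y_def power2_norm_eq_inner)
      have "u t \<bullet> U t \<le> y * a" unfolding y_def a_def by (rule norm_cauchy_schwarz)
      moreover have "(u t - lam * V t) \<bullet> V t \<le> (y + l * v) * v"
      proof -
        have "norm (u t - lam * V t) \<le> y + l * v"
          using norm_triangle_ineq4[of "u t" "lam * V t"] by (simp add: y_def l_def v_def norm_mult)
        then have "norm (u t - lam * V t) * v \<le> (y + l * v) * v" using nn by (intro mult_right_mono)
        then show ?thesis using norm_cauchy_schwarz[of "u t - lam * V t" "V t"] by (simp add: v_def)
      qed
      moreover have "u' \<bullet> u t \<le> (1 * y + l * (1 * a + 9/8 * v)) * y"
      proof -
        have "norm u' \<le> norm (of_real (b t) * u t) + norm (lam * (of_real (w t) * U t + of_real (z t) * V t))"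
          unfolding u'_def by (rule norm_triangle_ineq)
        also have "\<dots> \<le> 1 * y + l * (1 * a + 9/8 * v)"
        proof (rule add_mono)
          show "norm (of_real (b t) * u t) \<le> 1 * y"
            using b[of t] \<beta>_small unfolding norm_mult y_def by (intro mult_right_mono) auto
          have "norm (of_real (w t) * U t + of_real (z t) * V t)
             \<le> norm (of_real (w t) * U t) + norm (of_real (z t) * V t)" by (rule norm_triangle_ineq)
          also have "\<dots> \<le> 1 * a + 9/8 * v"
            unfolding norm_mult a_def v_def norm_of_real using w[of t] z_bounds[of t]
            by (intro add_mono mult_right_mono) auto
          finally show "norm (lam * (of_real (w t) * U t + of_real (z t) * V t)) \<le> l * (1 * a + 9/8 * v)"
            unfolding norm_mult l_def by (intro mult_left_mono) auto
        qed
        finally have "norm u' * y \<le> (1 * y + l * (1 * a + 9/8 * v)) * y"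
          using nn by (intro mult_right_mono) auto
        then show ?thesis using norm_cauchy_schwarz[of u' "u t"] by (simp add: y_def)
      qed
      ultimately have "N' \<le> 2 * (y * a) + 2 * ((y + l * v) * v) + 2 * ((y + l * (a + 9/8 * v)) * y)"
        unfolding N'_def by simp
      also have "\<dots> \<le> C * N t"
      proof -
        have e: "C * N t - (2 * (y * a) + 2 * ((y + l * v) * v) + 2 * ((y + l * (a + 9/8 * v)) * y))
          = (a - y)\<^sup>2 + (v - y)\<^sup>2 + 3 * a\<^sup>2 + 3 * v\<^sup>2
            + l * ((a - y)\<^sup>2 + 9/8 * (v - y)\<^sup>2 + 3 * a\<^sup>2 + 7/8 * v\<^sup>2 + 15/8 * y\<^sup>2)"
          unfolding Nt C_def l_def[symmetric] by (simp add: power2_eq_square field_simps)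
        have "0 \<le> \<dots>" using nn by (intro add_nonneg_nonneg mult_nonneg_nonneg) auto
        then show ?thesis using e by linarith
      qed
      finally have *: "N' \<le> C * N t" .
      have "((\<lambda>t. N t * exp (- C * t)) has_real_derivative ((N' - C * N t) * exp (- C * t))) (at t)"
        by (auto intro!: derivative_eq_intros dN simp: algebra_simps)
      moreover have "(N' - C * N t) * exp (- C * t) \<le> 0"
        using * by (intro mult_nonpos_nonneg) auto
      ultimately show "\<exists>y. ((\<lambda>t. N t * exp (- C * t)) has_real_derivative y) (at t) \<and> y \<le> 0" by blast
    qed
    also have "N x1 = 0" using at1 by (simp add: N_def)
    finally have "N x \<le> 0" by (simp add: mult_le_0_iff)
    moreover have "0 \<le> U x \<bullet> U x" "0 \<le> V x \<bullet> V x" "0 \<le> u x \<bullet> u x" by auto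
    ultimately have "U x \<bullet> U x = 0" "V x \<bullet> V x = 0" "u x \<bullet> u x = 0" unfolding N_def by linarith+
    then show ?thesis by simp
  qed
qed

text \<open>At the wall \<open>Re (u U\<^sup>*) = - s Re (V U\<^sup>*)\<close> is at most \<open>s \<bar>D\<bar> \<bar>U\<bar>\<close>, so \<open>F(0)\<close>, and hence the total dissipation,
  is of order \<open>\<beta> \<bar>U(0)\<bar>\<^sup>2\<close>. On \<open>[-1, 0]\<close> this makes \<open>U\<close> nearly constant and \<open>D\<close> small on average, whereas
  \<open>D' = - \<lambda> (U + D)\<close> moves \<open>D\<close> by about \<open>\<lambda> U(0)\<close>.\<close>
lemma small_frequency:
  assumes nz: "U 0 \<noteq> 0"
  shows "norm lam < 1 / 64"
proof (rule ccontr)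
  assume big: "\<not> norm lam < 1 / 64"
  define \<delta> :: real where "\<delta> = 1 / 10000"
  define m where "m = norm (U 0)"
  define t where "t = norm (D 0)"
  define l where "l = norm lam"
  have m: "0 < m" using nz by (simp add: m_def)
  have \<beta>\<delta>: "\<beta> = \<delta> ^ 4" by (simp add: \<beta>_def \<delta>_def)
  have U0: "U 0 \<bullet> U 0 = m\<^sup>2" "D 0 \<bullet> D 0 = t\<^sup>2" by (simp_all add: m_def t_def power2_norm_eq_inner)
  have t0: "0 \<le> t" by (simp add: t_def)
  have R0: "u 0 \<bullet> U 0 \<le> \<beta> * (t * m)"
  proof -
    have "u 0 \<bullet> U 0 = - s 0 * m\<^sup>2 + s 0 * (- (D 0 \<bullet> U 0))"
      unfolding U0(1)[symmetric] bc by (simp add: inner_complex_def algebra_simps)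
    also have "\<dots> \<le> 0 + s 0 * (t * m)"
      using s[of 0] norm_cauchy_schwarz[of "- D 0" "U 0"] norm_minus_commute[of "U 0" "V 0"]
      by (intro add_mono mult_left_mono) (auto simp: t_def m_def inner_diff_left)
    also have "\<dots> \<le> \<beta> * (t * m)" using s[of 0] t0 m by (simp add: mult_right_mono)
    finally show ?thesis .
  qed
  have "b 0 / 2 * m\<^sup>2 \<ge> - (\<beta> / 2) * m\<^sup>2" using b[of 0] by (intro mult_right_mono) auto
  note b0 = this
  have t_le: "t \<le> 2 * \<delta>\<^sup>2 * m"
  proof (rule ccontr)
    assume neg: "\<not> ?thesis"
    then have mt: "\<delta>\<^sup>2 * m \<le> t / 2" by simp
    have "7/16 * t\<^sup>2 \<le> z 0 / 2 * t\<^sup>2" using z_bounds[of 0] by (intro mult_right_mono) auto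
    also have "\<dots> \<le> \<beta> / 2 * m\<^sup>2 + \<beta> * (t * m)" using coercive[of 0] R0 b0 unfolding U0 by simp
    also have "\<beta> / 2 * m\<^sup>2 = (\<delta>\<^sup>2 * m)\<^sup>2 / 2" unfolding \<beta>\<delta> by (simp add: power2_eq_square power4_eq_xxxx)
    also have "\<dots> \<le> (t / 2)\<^sup>2 / 2" using mt m by (intro divide_right_mono power_mono) auto
    also have "\<beta> * (t * m) = \<delta>\<^sup>2 * (t * (\<delta>\<^sup>2 * m))" unfolding \<beta>\<delta> by (simp add: power2_eq_square power4_eq_xxxx)
    also have "\<dots> \<le> \<delta>\<^sup>2 * (t * (t / 2))" using mt t0 by (intro mult_left_mono) auto
    finally have "7/16 * t\<^sup>2 \<le> (1/8 + \<delta>\<^sup>2 / 2) * t\<^sup>2" by (simp add: power2_eq_square field_simps)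
    moreover have "0 < t" using neg m by (smt (verit) mult_nonneg_nonneg zero_le_power2)
    ultimately show False by (simp add: \<delta>_def power2_eq_square)
  qed
  have F0: "F 0 \<le> \<beta> * m\<^sup>2"
  proof -
    have "F 0 \<le> (\<beta> * (t * m) + \<beta> / 2 * m\<^sup>2) / z 0"
    proof -
      have "(u 0 \<bullet> U 0 - b 0 / 2 * m\<^sup>2) / z 0 \<le> (\<beta> * (t * m) + \<beta> / 2 * m\<^sup>2) / z 0"
        using R0 b0 z_bounds(3)[of 0] by (intro divide_right_mono) auto
      then show ?thesis unfolding F_def U0 using zero_le_power2[of t] by linarith
    qed
    also have "\<dots> \<le> (\<beta> * (t * m) + \<beta> / 2 * m\<^sup>2) / (7/8)"
      using z_bounds[of 0] \<beta>_small t0 m by (intro divide_left_mono) auto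
    also have "\<beta> * (t * m) \<le> \<beta> * ((2 * \<delta>\<^sup>2 * m) * m)"
      using t_le m \<beta>_small by (intro mult_left_mono mult_right_mono) auto
    finally have "F 0 \<le> (4/7 + 16/7 * \<delta>\<^sup>2) * (\<beta> * m\<^sup>2)"
      by (simp add: power2_eq_square field_simps)
    also have "\<dots> \<le> 1 * (\<beta> * m\<^sup>2)"
      using \<beta>_small(1) by (intro mult_right_mono) (auto simp: \<delta>_def power2_eq_square)
    finally show ?thesis by simp
  qed
  obtain F' where F': "\<And>x. x < 0 \<Longrightarrow> (F has_real_derivative F' x) (at x)"
      "\<And>x. x < 0 \<Longrightarrow> u x \<bullet> u x \<le> 3 * F' x"
    using F_dissipation by metis
  have near: "norm (U 0 - U x) \<le> 4 * \<delta>\<^sup>2 * m" if x: "-1 \<le> x" "x \<le> 0" for x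
  proof (cases "x = 0")
    case True then show ?thesis using m by simp
  next
    case False
    \<comment> \<open>\<open>\<kappa>\<close> optimises Young's inequality \<open>\<bar>u\<bar> \<le> \<bar>u\<bar>\<^sup>2 / \<kappa> + \<kappa> / 4\<close>, as the dissipation is of order \<open>\<kappa>\<^sup>2\<close>.\<close>
    define \<kappa> where "\<kappa> = \<delta>\<^sup>2 * m"
    have \<kappa>: "0 < \<kappa>" using m by (simp add: \<kappa>_def \<delta>_def)
    have "norm (U 0 - U x) \<le> (3 / \<kappa> * F 0 + \<kappa> / 4 * 0) - (3 / \<kappa> * F x + \<kappa> / 4 * x)"
    proof (rule differentiable_bound_general[of x 0 U "\<lambda>y. 3 / \<kappa> * F y + \<kappa> / 4 * y" u "\<lambda>y. 3 / \<kappa> * F' y + \<kappa> / 4"])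
      show "x < 0" using x False by simp
      show "continuous_on {x..0} U" by (rule continuous_on_subset[OF cont(1)]) auto
      show "continuous_on {x..0} (\<lambda>y. 3 / \<kappa> * F y + \<kappa> / 4 * y)"
        by (intro continuous_intros continuous_on_subset[OF cont_F]) auto
      fix y :: real assume y: "x < y" "y < 0"
      show "(U has_vector_derivative u y) (at y)" using dU y by simp
      show "((\<lambda>y. 3 / \<kappa> * F y + \<kappa> / 4 * y) has_vector_derivative 3 / \<kappa> * F' y + \<kappa> / 4) (at y)"
        unfolding has_real_derivative_iff_has_vector_derivative[symmetric]
        using y \<kappa> by (auto intro!: derivative_eq_intros F')
      have "0 \<le> (norm (u y) / \<kappa> - 1 / 2)\<^sup>2 * \<kappa>" using \<kappa> by simp
      also have "\<dots> = (norm (u y))\<^sup>2 / \<kappa> - norm (u y) + \<kappa> / 4"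
        using \<kappa> by (simp add: power2_eq_square field_simps)
      also have "(norm (u y))\<^sup>2 / \<kappa> \<le> 3 * F' y / \<kappa>"
        using F'(2)[OF y(2)] \<kappa> by (intro divide_right_mono) (auto simp: power2_norm_eq_inner)
      finally show "norm (u y) \<le> 3 / \<kappa> * F' y + \<kappa> / 4" by simp
    qed
    also have "\<dots> \<le> 3 / \<kappa> * F 0 + \<kappa> / 4"
    proof -
      have "0 \<le> 3 / \<kappa> * F x" using F_nonneg x \<kappa> by simp
      moreover have "\<kappa> / 4 * (- x) \<le> \<kappa> / 4 * 1" using x \<kappa> by (intro mult_left_mono) auto
      ultimately show ?thesis by simp
    qed
    also have "\<dots> \<le> 3 / \<kappa> * (\<kappa> * \<kappa>) + \<kappa> / 4"
      using F0 \<kappa> by (intro add_right_mono mult_left_mono)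
        (auto simp: \<kappa>_def \<beta>\<delta> power2_eq_square power4_eq_xxxx mult_ac)
    also have "\<dots> \<le> 4 * \<kappa>" using \<kappa> by simp
    finally show ?thesis by (simp add: \<kappa>_def)
  qed
  define N where "N x = U x \<bullet> U x" for x
  have N_eq: "N x = (norm (U x))\<^sup>2" for x by (simp add: N_def power2_norm_eq_inner)
  have nU: "(1 - 4 * \<delta>\<^sup>2) * m \<le> norm (U x)" "norm (U x) \<le> (1 + 4 * \<delta>\<^sup>2) * m"
    if x: "-1 \<le> x" "x \<le> 0" for x
    using near[OF that] norm_triangle_ineq3[of "U 0" "U x"] unfolding m_def[symmetric]
    by (auto simp: algebra_simps abs_le_iff)
  have N_bounds: "(1 - 8 * \<delta>\<^sup>2) * m\<^sup>2 \<le> N x" "N x \<le> (1 + 9 * \<delta>\<^sup>2) * m\<^sup>2"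
    if x: "-1 \<le> x" "x \<le> 0" for x
  proof -
    have "((1 - 4 * \<delta>\<^sup>2) * m)\<^sup>2 \<le> N x" unfolding N_eq
      using nU[OF x] m by (intro power_mono) (auto simp: \<delta>_def power2_eq_square)
    moreover have "(1 - 8 * \<delta>\<^sup>2) * m\<^sup>2 \<le> ((1 - 4 * \<delta>\<^sup>2) * m)\<^sup>2"
      unfolding power_mult_distrib by (intro mult_right_mono) (auto simp: \<delta>_def power2_eq_square)
    ultimately show "(1 - 8 * \<delta>\<^sup>2) * m\<^sup>2 \<le> N x" by linarith
    have "N x \<le> ((1 + 4 * \<delta>\<^sup>2) * m)\<^sup>2" unfolding N_eq
      using nU[OF x] by (intro power_mono) auto
    moreover have "((1 + 4 * \<delta>\<^sup>2) * m)\<^sup>2 \<le> (1 + 9 * \<delta>\<^sup>2) * m\<^sup>2"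
      unfolding power_mult_distrib by (intro mult_right_mono) (auto simp: \<delta>_def power2_eq_square)
    ultimately show "N x \<le> (1 + 9 * \<delta>\<^sup>2) * m\<^sup>2" by linarith
  qed
  have dN: "(N has_real_derivative 2 * (u x \<bullet> U x)) (at x)" if "x < 0" for x
    unfolding N_def using has_real_derivative_inner[OF dU[OF that] dU[OF that]] by (simp add: inner_commute)
  have D_le: "(norm (D x))\<^sup>2 \<le> 8/7 * (2 * (u x \<bullet> U x) + 2 * \<beta> * m\<^sup>2)" if x: "-1 \<le> x" "x \<le> 0" for x
  proof -
    have "7/8 * (norm (D x))\<^sup>2 \<le> z x * (norm (D x))\<^sup>2" using z_bounds[of x] by (intro mult_right_mono) auto
    also have "\<dots> \<le> 2 * (u x \<bullet> U x) + - b x * N x"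
      using coercive[OF x(2)] by (simp add: N_def power2_norm_eq_inner)
    also have "- b x * N x \<le> \<beta> * N x" using b[of x] by (intro mult_right_mono) (auto simp: N_def)
    also have "\<beta> * N x \<le> \<beta> * (2 * m\<^sup>2)"
    proof (rule mult_left_mono)
      have "(1 + 9 * \<delta>\<^sup>2) * m\<^sup>2 \<le> 2 * m\<^sup>2" by (intro mult_right_mono) (auto simp: \<delta>_def power2_eq_square)
      then show "N x \<le> 2 * m\<^sup>2" using N_bounds(2)[OF x] by linarith
    qed (use \<beta>_small in simp)
    finally show ?thesis by simp
  qed
  \<comment> \<open>As \<open>\<bar>U\<bar>\<^sup>2\<close> hardly varies, its derivative \<open>2 Re (u U\<^sup>*)\<close>, which bounds \<open>\<bar>D\<bar>\<^sup>2\<close>, is small at some point;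
    that point is taken in \<open>(-1, -1/2)\<close> to keep it away from the wall.\<close>
  obtain r where r: "-1 < r" "r < -1/2" "N (-1/2) - N (-1) = (-1/2 - -1) * (2 * (u r \<bullet> U r))"
    using MVT2[of "-1" "-1/2" N "\<lambda>x. 2 * (u x \<bullet> U x)"] dN by auto
  have Rr: "u r \<bullet> U r \<le> 17 * \<delta>\<^sup>2 * m\<^sup>2"
    using r(3) N_bounds[of "-1"] N_bounds[of "-1/2"] by (simp add: algebra_simps)
  have Dr: "norm (D r) \<le> 7 * \<delta> * m"
  proof (rule power2_le_imp_le)
    have "(norm (D r))\<^sup>2 \<le> 8/7 * (34 * \<delta>\<^sup>2 * m\<^sup>2 + 2 * \<beta> * m\<^sup>2)"
      using D_le[of r] Rr r by simp
    also have "\<dots> \<le> (7 * \<delta> * m)\<^sup>2"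
      using m unfolding \<beta>\<delta> by (simp add: power_mult_distrib power2_eq_square power4_eq_xxxx \<delta>_def)
    finally show "(norm (D r))\<^sup>2 \<le> (7 * \<delta> * m)\<^sup>2" .
  qed (use m in \<open>simp add: \<delta>_def\<close>)
  \<comment> \<open>Bounding \<open>\<bar>D\<bar> \<le> m / 4 + \<bar>D\<bar>\<^sup>2 / m\<close> turns the speed of \<open>D + x \<lambda> U(0)\<close> into the derivative of an explicit
    function, because \<open>\<bar>D\<bar>\<^sup>2\<close> is controlled by the derivative of \<open>N = \<bar>U\<bar>\<^sup>2\<close>; the loss \<open>m / 4\<close> stays
    below the driving term \<open>m\<close>.\<close>
  define k where "k = m / 4 + 4 * \<delta>\<^sup>2 * m + 3 * \<beta> * m"
  have moved: "norm ((D 0 + of_real 0 * (lam * U 0)) - (D r + of_real r * (lam * U 0)))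
     \<le> l * (k * 0 + 8 / (7 * m) * N 0) - l * (k * r + 8 / (7 * m) * N r)"
  proof (rule differentiable_bound_general[where f = "\<lambda>x. D x + of_real x * (lam * U 0)"
        and f' = "\<lambda>x. - (lam * V x) + lam * U 0" and \<phi> = "\<lambda>x. l * (k * x + 8 / (7 * m) * N x)"
        and \<phi>' = "\<lambda>x. l * (k + 8 / (7 * m) * (2 * (u x \<bullet> U x)))"])
    show "r < 0" using r by simp
    show "continuous_on {r..0} (\<lambda>x. D x + of_real x * (lam * U 0))"
      by (intro continuous_intros continuous_on_subset[OF cont(1)] continuous_on_subset[OF cont(2)]) auto
    show "continuous_on {r..0} (\<lambda>x. l * (k * x + 8 / (7 * m) * N x))" unfolding N_def
      by (intro continuous_intros continuous_on_subset[OF cont(1)]) auto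
    fix x :: real assume x: "r < x" "x < 0"
    show "((\<lambda>x. D x + of_real x * (lam * U 0)) has_vector_derivative - (lam * V x) + lam * U 0) (at x)"
      by (rule has_vector_derivative_eq_rhs[OF has_vector_derivative_add[OF deriv_D[OF x(2)]
            has_vector_derivative_mult_left[OF has_vector_derivative_of_real[OF DERIV_ident]]]]) simp
    show "((\<lambda>x. l * (k * x + 8 / (7 * m) * N x)) has_vector_derivative
        l * (k + 8 / (7 * m) * (2 * (u x \<bullet> U x)))) (at x)"
      unfolding has_real_derivative_iff_has_vector_derivative[symmetric]
      using x m by (auto intro!: derivative_eq_intros dN)
    have x1: "-1 \<le> x" "x \<le> 0" using x r by auto
    have "- (lam * V x) + lam * U 0 = lam * ((U 0 - U x) - D x)" by (simp add: algebra_simps)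
    then have "norm (- (lam * V x) + lam * U 0) = l * norm ((U 0 - U x) - D x)"
      by (simp only: norm_mult l_def)
    also have "\<dots> \<le> l * (4 * \<delta>\<^sup>2 * m + norm (D x))"
      using norm_triangle_ineq4[of "U 0 - U x" "D x"] near[OF x1] by (intro mult_left_mono) (auto simp: l_def)
    also have "\<dots> \<le> l * (k + 8 / (7 * m) * (2 * (u x \<bullet> U x)))"
    proof (rule mult_left_mono)
      have "0 \<le> m * (norm (D x) / m - 1/2)\<^sup>2" using m by simp
      also have "\<dots> = (norm (D x))\<^sup>2 / m - norm (D x) + m / 4"
        using m by (simp add: power2_eq_square field_simps)
      also have "(norm (D x))\<^sup>2 / m \<le> (8/7 * (2 * (u x \<bullet> U x) + 2 * \<beta> * m\<^sup>2)) / m"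
        using D_le[OF x1] m by (intro divide_right_mono) auto
      also have "\<dots> = 8 / (7 * m) * (2 * (u x \<bullet> U x)) + 16/7 * \<beta> * m"
        using m by (simp add: power2_eq_square field_simps)
      finally have "norm (D x) \<le> 8 / (7 * m) * (2 * (u x \<bullet> U x)) + 16/7 * \<beta> * m + m / 4" by linarith
      moreover have "16/7 * \<beta> * m \<le> 3 * \<beta> * m" using m \<beta>_small by (intro mult_right_mono) auto
      ultimately show "4 * \<delta>\<^sup>2 * m + norm (D x) \<le> k + 8 / (7 * m) * (2 * (u x \<bullet> U x))"
        unfolding k_def by linarith
    qed (simp add: l_def)
    finally show "norm (- (lam * V x) + lam * U 0) \<le> l * (k + 8 / (7 * m) * (2 * (u x \<bullet> U x)))" .
  qed
  have up: "norm (D 0 - (D r + of_real r * (lam * U 0))) \<le> l * (k * (- r)) + l * (11 * \<delta>\<^sup>2 * m)"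
  proof -
    have "N 0 = m\<^sup>2" by (simp add: N_def U0)
    moreover have "m\<^sup>2 - 8 * (\<delta>\<^sup>2 * m\<^sup>2) \<le> N r"
      using N_bounds(1)[of r] r by (simp add: left_diff_distrib mult.assoc)
    moreover have "0 \<le> \<delta>\<^sup>2 * m\<^sup>2" by simp
    ultimately have "N 0 - N r \<le> 9 * (\<delta>\<^sup>2 * m\<^sup>2)" by linarith
    then have "8 / (7 * m) * (N 0 - N r) \<le> 8 / (7 * m) * (9 * (\<delta>\<^sup>2 * m\<^sup>2))"
      using m by (intro mult_left_mono) auto
    also have "\<dots> = 72/7 * \<delta>\<^sup>2 * m" using m by (simp add: power2_eq_square)
    also have "\<dots> \<le> 11 * \<delta>\<^sup>2 * m" using m by (intro mult_right_mono) auto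
    finally have "l * (8 / (7 * m) * (N 0 - N r)) \<le> l * (11 * \<delta>\<^sup>2 * m)"
      by (intro mult_left_mono) (auto simp: l_def)
    moreover have "l * (k * 0 + 8 / (7 * m) * N 0) - l * (k * r + 8 / (7 * m) * N r)
        = l * (k * (- r)) + l * (8 / (7 * m) * (N 0 - N r))"
      by (simp only: right_diff_distrib distrib_left mult_zero_right mult_minus_right)
    ultimately show ?thesis using moved by simp
  qed
  have "l * m * (- r) = norm (of_real r * (lam * U 0))"
    using r by (simp add: norm_mult l_def m_def)
  also have "\<dots> \<le> norm (D 0 - (D r + of_real r * (lam * U 0))) + norm (D 0) + norm (D r)"
  proof -
    define Y where "Y = D 0 - (D r + of_real r * (lam * U 0))"
    have "of_real r * (lam * U 0) = (D 0 - Y) - D r" by (simp add: Y_def)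
    then have "norm (of_real r * (lam * U 0)) \<le> norm (D 0 - Y) + norm (D r)"
      by (simp only: norm_triangle_ineq4)
    also have "norm (D 0 - Y) \<le> norm (D 0) + norm Y" by (rule norm_triangle_ineq4)
    finally show ?thesis unfolding Y_def by linarith
  qed
  also have "\<dots> \<le> l * (k * (- r)) + l * (11 * \<delta>\<^sup>2 * m) + 2 * \<delta>\<^sup>2 * m + 7 * \<delta> * m"
    using up t_le Dr unfolding t_def[symmetric] by simp
  finally have *: "l * m * (- r) \<le> l * (k * (- r)) + l * (11 * \<delta>\<^sup>2 * m) + 2 * \<delta>\<^sup>2 * m + 7 * \<delta> * m" .
  have "k = (1/4 + 4 * \<delta>\<^sup>2 + 3 * \<beta>) * m" by (simp add: k_def algebra_simps)
  also have "\<dots> \<le> (1/3) * m"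
    using m \<beta>_small(2) by (intro mult_right_mono) (auto simp: \<delta>_def power2_eq_square)
  finally have "k \<le> m / 3" by simp
  then have "l * (k * (- r)) \<le> l * (m / 3 * (- r))" using r by (intro mult_left_mono mult_right_mono) (auto simp: l_def)
  with * have "m * (2/3 * (l * (- r)) - 11 * \<delta>\<^sup>2 * l) \<le> m * (2 * \<delta>\<^sup>2 + 7 * \<delta>)"
    by (simp add: algebra_simps)
  then have "2/3 * (l * (- r)) - 11 * \<delta>\<^sup>2 * l \<le> 2 * \<delta>\<^sup>2 + 7 * \<delta>" using m by simp
  moreover have "l * (1/2) \<le> l * (- r)" using r by (intro mult_left_mono) (auto simp: l_def)
  moreover have "1/64 \<le> l" using big by (simp add: l_def)
  ultimately show False by (simp add: \<delta>_def power2_eq_square)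
qed

text \<open>From here on the mode is studied through the logarithmic derivative of \<open>U\<close> and the relative size of the fast
  component.\<close>
definition P where "P x = u x / U x"

definition d where "d x = D x / U x"

lemma U_nonzero: "U 0 \<noteq> 0 \<Longrightarrow> x \<le> 0 \<Longrightarrow> U x \<noteq> 0"
  using vanishing[of x 0] by auto

lemma V_over_U: "U 0 \<noteq> 0 \<Longrightarrow> x \<le> 0 \<Longrightarrow> V x / U x = 1 + d x"
  using U_nonzero[of x] by (simp add: d_def field_simps)

lemma cont_ratios:
  assumes "U 0 \<noteq> 0"
  shows "continuous_on {..0} P" "continuous_on {..0} d"
  unfolding P_def d_def using U_nonzero[OF assms] by (auto intro!: continuous_intros cont)

lemma coercive_ratio:
  assumes nz: "U 0 \<noteq> 0" and x: "x \<le> 0"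
  shows "b x / 2 + z x / 2 * (d x \<bullet> d x) \<le> Re (P x)"
proof -
  define n where "n = (norm (U x))\<^sup>2"
  have n: "0 < n" using U_nonzero[OF nz x] by (simp add: n_def)
  have "(d x \<bullet> d x) * n = D x \<bullet> D x"
    using U_nonzero[OF nz x] by (simp add: d_def n_def power2_norm_eq_inner[symmetric] norm_divide power_divide)
  moreover have "Re (P x) * n = u x \<bullet> U x"
  proof -
    have "Re (P x) = (u x \<bullet> U x) / n" by (simp add: P_def n_def Re_divide inner_complex_def cmod_power2)
    then show ?thesis using n by simp
  qed
  moreover have "b x / 2 * n + z x / 2 * (D x \<bullet> D x) \<le> u x \<bullet> U x"
    using coercive[OF x] by (simp add: n_def power2_norm_eq_inner)
  ultimately have "(b x / 2 + z x / 2 * (d x \<bullet> d x)) * n \<le> Re (P x) * n"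
    by (simp only: distrib_right mult.assoc)
  then show ?thesis using n by simp
qed

lemma deriv_ratio:
  assumes nz: "U 0 \<noteq> 0" and x: "x < 0"
  shows "(d has_vector_derivative - (lam * (1 + d x)) - d x * P x) (at x)"
  using has_vector_derivative_complex_divide[OF deriv_D[OF x] dU[OF x]] U_nonzero[OF nz, of x] V_over_U[OF nz, of x] x
  unfolding d_def[abs_def, symmetric] P_def[symmetric] d_def[symmetric] by (simp flip: times_divide_eq_right)

lemma Riccati_equation:
  assumes nz: "U 0 \<noteq> 0" and x: "x < 0"
  shows "(P has_vector_derivative
    of_real (b x) * P x + lam * (of_real (w x + z x) + of_real (z x) * d x) - P x * P x) (at x)"
proof -
  have "(of_real (b x) * u x + lam * (of_real (w x) * U x + of_real (z x) * V x)) / U x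
     = of_real (b x) * P x + lam * (of_real (w x) + of_real (z x) * (V x / U x))"
    using U_nonzero[OF nz, of x] x by (simp add: P_def field_simps)
  also have "\<dots> = of_real (b x) * P x + lam * (of_real (w x + z x) + of_real (z x) * d x)"
    using V_over_U[OF nz, of x] x by (simp add: algebra_simps)
  finally show ?thesis
    using has_vector_derivative_complex_divide[OF du[OF x] dU[OF x]] U_nonzero[OF nz, of x] x
    unfolding P_def[abs_def, symmetric] P_def[symmetric] by simp
qed

text \<open>Where \<open>\<bar>d\<bar> > 1/2\<close>, the lower bound \<open>Re P \<ge> z \<bar>d\<bar>\<^sup>2 / 2\<close> (up to a small error) turns
  \<open>d' = - \<lambda> (1 + d) - d P\<close> into a cubic damping of \<open>\<bar>d\<bar>\<close>, which dominates the source \<open>\<lambda>\<close> as \<open>\<bar>\<lambda>\<bar> \<le> 1/64\<close>.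
  Backwards this is a blow-up.\<close>
lemma ratio_small:
  assumes nz: "U 0 \<noteq> 0" and x: "x \<le> 0"
  shows "norm (d x) \<le> 1 / 2"
proof (rule ccontr)
  define l where "l = norm lam"
  have l: "0 \<le> l" "l \<le> 1/64" using small_frequency[OF nz] by (simp_all add: l_def)
  assume "\<not> norm (d x) \<le> 1 / 2"
  then have "(1/2)\<^sup>2 < (norm (d x))\<^sup>2" by (intro power_strict_mono) auto
  then have start: "1/4 < d x \<bullet> d x" unfolding power2_norm_eq_inner by (simp add: power2_eq_square)
  show False
  proof (rule no_backward_quadratic_decay[of "1/4" "1/2" "\<lambda>x. d x \<bullet> d x" x
        "\<lambda>x. 2 * (d x \<bullet> (- (lam * (1 + d x)) - d x * P x))"])
    show "continuous_on {..x} (\<lambda>x. d x \<bullet> d x)"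
      using x by (intro continuous_intros continuous_on_subset[OF cont_ratios(2)[OF nz]]) auto
    fix y assume y: "y < x"
    then have y0: "y < 0" using x by simp
    show "((\<lambda>x. d x \<bullet> d x) has_real_derivative 2 * (d y \<bullet> (- (lam * (1 + d y)) - d y * P y))) (at y)"
      using has_real_derivative_inner[OF deriv_ratio[OF nz y0] deriv_ratio[OF nz y0]] by (simp add: inner_commute)
    assume big: "1/4 < d y \<bullet> d y"
    define n where "n = norm (d y)"
    have n2: "d y \<bullet> d y = n\<^sup>2" by (simp add: n_def power2_norm_eq_inner)
    have n: "1/2 < n" using big unfolding n2
      using power2_less_imp_less[of "1/2" n] by (simp add: n_def power2_eq_square)
    have "d y \<bullet> (- (lam * (1 + d y)) - d y * P y) = - (d y \<bullet> lam) - Re lam * n\<^sup>2 - n\<^sup>2 * Re (P y)"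
      unfolding n2[symmetric] by (simp add: inner_complex_def algebra_simps)
    also have "\<dots> \<le> n * l - 0 - n\<^sup>2 * (b y / 2 + z y / 2 * n\<^sup>2)"
      using norm_cauchy_schwarz[of "- d y" lam] coercive_ratio[OF nz, of y] y0 lam(2)
      by (intro diff_mono mult_left_mono) (auto simp: n_def l_def power2_norm_eq_inner)
    also have "\<dots> \<le> - (1/4) * (n\<^sup>2)\<^sup>2"
    proof -
      define q where "q = n\<^sup>2 * n\<^sup>2"
      have "n * l \<le> n * (1/64)" using l n by (intro mult_left_mono) auto
      moreover have "n * (1/2)^3 \<le> n * n^3" using n by (intro mult_left_mono power_mono) auto
      then have "n * (1/8) \<le> q" by (simp add: q_def power2_eq_square power3_eq_cube mult_ac)
      moreover have "n\<^sup>2 * (- b y / 2) \<le> n\<^sup>2 * (1/100)"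
        using b[of y] \<beta>_small by (intro mult_left_mono) auto
      moreover have "n\<^sup>2 * (1/2)\<^sup>2 \<le> q" unfolding q_def using n by (intro mult_left_mono power_mono) auto
      then have "n\<^sup>2 * (1/4) \<le> q" by (simp add: power2_eq_square)
      moreover have "(7/16) * q \<le> z y / 2 * q"
        using z_bounds[of y] by (intro mult_right_mono) (auto simp: q_def)
      moreover have eq: "n * l - 0 - n\<^sup>2 * (b y / 2 + z y / 2 * n\<^sup>2) = n * l + n\<^sup>2 * (- b y / 2) - z y / 2 * q"
        unfolding q_def by (simp add: algebra_simps)
      moreover have "0 \<le> q" by (simp add: q_def)
      ultimately have "n * l + n\<^sup>2 * (- b y / 2) - z y / 2 * q \<le> - (1/4) * q" by argo
      moreover have "(n\<^sup>2)\<^sup>2 = q" by (simp add: q_def power2_eq_square)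
      ultimately show ?thesis unfolding eq by simp
    qed
    finally show "2 * (d y \<bullet> (- (lam * (1 + d y)) - d y * P y)) \<le> - (1/2) * (d y \<bullet> d y)\<^sup>2"
      unfolding n2 by simp
  qed (use start in auto)
qed

text \<open>The boundary condition gives \<open>P(0) = - s(0) (1 + d(0))\<close>, outside the half-plane \<open>Re P + \<tau> Im P \<ge> 0\<close> since
  \<open>\<bar>d(0)\<bar> \<le> 1/2\<close>. The Riccati equation pushes solutions into this half-plane, so backwards from the wall \<open>P\<close>
  moves away from it, and quadratically fast.\<close>
lemma boundary_value_vanishes: "U 0 = 0"
proof (rule ccontr)
  assume nz: "U 0 \<noteq> 0"
  define l where "l = norm lam"
  have l: "0 \<le> l" "l \<le> 1/64" using small_frequency[OF nz] by (simp_all add: l_def)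
  define \<tau> :: real where "\<tau> = (if 0 \<le> Im lam then 1 else - 1)"
  define E where "E = Complex 1 \<tau>"
  have \<tau>2: "\<tau> * \<tau> = 1" by (simp add: \<tau>_def)
  have normE: "norm E \<le> 3/2"
  proof (rule power2_le_imp_le)
    have "(norm E)\<^sup>2 = 1 + \<tau> * \<tau>" unfolding E_def cmod_power2 by (simp add: power2_eq_square)
    then show "(norm E)\<^sup>2 \<le> (3/2)\<^sup>2" unfolding \<tau>2 by (simp add: power2_eq_square)
  qed simp
  have innerE: "- (3/4) \<le> d x \<bullet> E" if "x \<le> 0" for x
  proof -
    have "norm (d x) * norm E \<le> 1/2 * (3/2)" using ratio_small[OF nz that] normE by (intro mult_mono) auto
    then show ?thesis using norm_cauchy_schwarz[of "- d x" E] by simp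
  qed
  \<comment> \<open>\<open>P \<bullet> E = Re P + \<tau> Im P\<close>; the weight \<open>s\<close>, with \<open>s' = b s\<close>, and the bound \<open>Re P \<ge> b / 2\<close> together
    cancel the terms that are linear in \<open>b\<close>.\<close>
  define M where "M x = - (s x * (P x \<bullet> E))" for x
  define P' where "P' x = of_real (b x) * P x + lam * (of_real (w x + z x) + of_real (z x) * d x) - P x * P x" for x
  show False
  proof (rule no_backward_quadratic_decay[of 0 1 M 0 "\<lambda>x. - (b x * s x * (P x \<bullet> E) + s x * (P' x \<bullet> E))"])
    have P0: "P 0 = - of_real (s 0) * (1 + d 0)"
      unfolding V_over_U[OF nz order_refl, symmetric] P_def bc by simp
    have "M 0 = s 0 * s 0 * ((1 + d 0) \<bullet> E)"
      unfolding M_def P0 by (simp add: inner_complex_def algebra_simps)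
    moreover have "(1 + d 0) \<bullet> E = 1 + d 0 \<bullet> E" by (simp add: inner_add_left E_def inner_complex_def)
    ultimately show "0 < M 0" using innerE[of 0] s[of 0] by simp
    show "continuous_on {..0} M" unfolding M_def by (intro continuous_intros cont_ratios(1)[OF nz] cont_coeff)
    fix x :: real assume x: "x < 0"
    have "((\<lambda>x. P x \<bullet> E) has_real_derivative P' x \<bullet> E) (at x)"
      using has_real_derivative_inner[OF Riccati_equation[OF nz x] has_vector_derivative_const[of E]]
      by (simp add: P'_def)
    from DERIV_minus[OF DERIV_mult[OF ds this]]
    show "(M has_real_derivative - (b x * s x * (P x \<bullet> E) + s x * (P' x \<bullet> E))) (at x)"
      unfolding M_def by (simp add: mult_ac)
    assume "0 < M x"
    define p where "p = P x \<bullet> E"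
    define c where "c = Re (P x)"
    have p: "p < 0" using \<open>0 < M x\<close> s(1)[of x] by (simp add: M_def p_def mult_less_0_iff)
    \<comment> \<open>Here \<open>\<lambda> \<bullet> E = Re \<lambda> + \<bar>Im \<lambda>\<bar> \<ge> \<bar>\<lambda>\<bar>\<close>, by the choice of \<open>\<tau>\<close>, and \<open>\<bar>d\<bar> \<le> 1/2\<close> perturbs it too little to change
      the sign.\<close>
    have forcing: "0 \<le> (lam * (of_real (w x + z x) + of_real (z x) * d x)) \<bullet> E"
    proof -
      have lamE: "lam \<bullet> E = Re lam + \<bar>Im lam\<bar>" by (simp add: E_def inner_complex_def \<tau>_def)
      have "l \<le> lam \<bullet> E" unfolding lamE l_def using cmod_le[of lam] lam(2) by simp
      moreover have "- (3/4 * l) \<le> (lam * d x) \<bullet> E"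
      proof -
        have "norm (lam * d x) * norm E \<le> (l * (1/2)) * (3/2)"
          using ratio_small[OF nz, of x] normE x l unfolding norm_mult l_def by (intro mult_mono) auto
        then show ?thesis using norm_cauchy_schwarz[of "- (lam * d x)" E] by simp
      qed
      moreover have eq: "(lam * (of_real (w x + z x) + of_real (z x) * d x)) \<bullet> E
        = (w x + z x) * (lam \<bullet> E) + z x * ((lam * d x) \<bullet> E)"
        by (simp add: inner_complex_def algebra_simps)
      ultimately have "(w x + z x) * l + z x * (- (3/4 * l)) \<le> (lam * (of_real (w x + z x) + of_real (z x) * d x)) \<bullet> E"
        unfolding eq using w[of x] z_bounds[of x] by (intro add_mono mult_left_mono) auto
      moreover have "(w x + z x) * l + z x * (- (3/4 * l)) = (w x + z x / 4) * l" by (simp add: field_simps)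
      moreover have "0 \<le> (w x + z x / 4) * l" using w[of x] z_bounds[of x] l by simp
      ultimately show ?thesis by linarith
    qed
    \<comment> \<open>With \<open>\<tau> Im P = p - c\<close>, the left-hand side is the \<open>E\<close> component of \<open>b P - P\<^sup>2\<close>.\<close>
    have Riccati: "b x * p - c * c + (p - c) * (p - c) - 2 * c * (p - c) \<le> P' x \<bullet> E"
    proof -
      have q: "p - c = \<tau> * Im (P x)" by (simp add: p_def c_def E_def inner_complex_def)
      have "(p - c) * (p - c) = Im (P x) * Im (P x)" unfolding q using \<tau>2 by (simp add: algebra_simps)
      then have "(P x * P x) \<bullet> E = c * c - (p - c) * (p - c) + 2 * c * (p - c)"
        unfolding q by (simp add: c_def E_def inner_complex_def algebra_simps)
      moreover have "(of_real (b x) * P x) \<bullet> E = b x * p"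
        unfolding p_def by (simp add: inner_complex_def algebra_simps)
      ultimately show ?thesis using forcing unfolding P'_def
        by (simp only: inner_diff_left inner_add_left)
    qed
    have "b x \<le> 2 * c"
    proof -
      have "0 \<le> z x / 2 * (d x \<bullet> d x)" using z_bounds[of x] by simp
      then show ?thesis using coercive_ratio[OF nz, of x] x by (simp add: c_def)
    qed
    then have *: "2 * p * (2 * c) \<le> 2 * p * b x" using p by (intro mult_left_mono_neg) auto
    have "- b x * p - P' x \<bullet> E \<le> - (p * p)"
    proof -
      have "b x * p - c * c + (p - c) * (p - c) - 2 * c * (p - c) = b x * p + p * p - 2 * p * (2 * c) + 2 * (c * c)"
        by (simp add: algebra_simps)
      moreover have "0 \<le> c * c" by simp
      ultimately have "b x * p + p * p - 2 * p * (2 * c) \<le> P' x \<bullet> E" using Riccati by argo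
      moreover have "2 * p * b x = 2 * (b x * p)" by simp
      ultimately show ?thesis using * by (simp only: minus_mult_left[symmetric])
    qed
    then have "s x * (- b x * p - P' x \<bullet> E) \<le> s x * (- (p * p))"
      using s(1)[of x] by (intro mult_left_mono) auto
    also have "\<dots> \<le> (s x * s x) * (- (p * p))"
    proof (rule mult_right_mono_neg)
      show "s x * s x \<le> s x" using s[of x] \<beta>_small by (intro mult_left_le) auto
    qed simp
    finally show "- (b x * s x * (P x \<bullet> E) + s x * (P' x \<bullet> E)) \<le> - 1 * (M x)\<^sup>2"
      unfolding M_def p_def[symmetric] by (simp add: algebra_simps power2_eq_square)
  qed simp_all
qed

theorem mode_is_trivial: "x \<le> 0 \<Longrightarrow> U x = 0 \<and> V x = 0 \<and> u x = 0"
  using vanishing[OF order_refl boundary_value_vanishes] .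

end

section \<open>Weak profiles\<close>
lemma profile_a_tendsto:
  assumes "1 \<le> \<gamma>"
  shows "(profile_a \<gamma> \<longlongrightarrow> 1 / \<gamma>) (at_left 1)"
proof -
  have "((\<lambda>x. x powr \<gamma>) has_real_derivative \<gamma>) (at 1 within {..<1})"
    by (auto intro!: derivative_eq_intros)
  then have "((\<lambda>y. (y powr \<gamma> - 1) / (y - 1)) \<longlongrightarrow> \<gamma>) (at_left 1)"
    unfolding has_field_derivative_iff by simp
  moreover have "((\<lambda>y. y powr \<gamma>) \<longlongrightarrow> 1 powr \<gamma>) (at_left 1)"
    by (intro tendsto_intros) auto
  ultimately have "((\<lambda>y. y powr \<gamma> / ((y powr \<gamma> - 1) / (y - 1))) \<longlongrightarrow> 1 powr \<gamma> / \<gamma>) (at_left 1)"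
    using assms by (intro tendsto_divide) auto
  moreover have "y powr \<gamma> / ((y powr \<gamma> - 1) / (y - 1)) = profile_a \<gamma> y" for y
    unfolding profile_a_def by (metis divide_divide_eq_right minus_diff_eq minus_divide_divide times_divide_eq_right)
  ultimately show ?thesis by simp
qed

text \<open>The right-hand side of the profile equation is, up to the factor \<open>y > 0\<close>, strictly convex and vanishes at
  \<open>vp\<close> and at \<open>1\<close>; the mean value theorem on both sides of \<open>y\<close> contradicts the monotonicity of its derivative
  unless it is negative in between.\<close>
lemma profile_speed_neg:
  assumes \<gamma>: "1 \<le> \<gamma>" and y: "0 < vp" "vp < y" "y < 1"
  shows "y - 1 + profile_a \<gamma> vp * (y powr (- \<gamma>) - 1) < 0"
proof (rule ccontr)
  define a where "a = profile_a \<gamma> vp"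
  define f where "f y = y - 1 + a * (y powr (- \<gamma>) - 1)" for y
  define f' where "f' y = 1 - a * \<gamma> * y powr (- \<gamma> - 1)" for y
  assume "\<not> ?thesis"
  then have fy: "0 \<le> f y" by (simp add: f_def a_def)
  have vp1: "vp powr \<gamma> < 1" using y \<gamma> powr_less_mono2[of \<gamma> vp 1] by simp
  have a: "0 < a" unfolding a_def profile_a_def using y vp1 by simp
  have f0: "f vp = 0" using vp1 y(1) unfolding f_def a_def profile_a_def powr_minus
    by (simp add: field_simps)
  have df: "(f has_real_derivative f' t) (at t)" if "0 < t" for t
    unfolding f_def f'_def using that by (auto intro!: derivative_eq_intros)
  obtain r where r: "vp < r" "r < y" "f y - f vp = (y - vp) * f' r"
    using MVT2[of vp y f f'] df y by auto
  obtain t where t: "y < t" "t < 1" "f 1 - f y = (1 - y) * f' t"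
    using MVT2[of y 1 f f'] df y by auto
  have "0 \<le> f' r" using r fy f0 y by (simp add: zero_le_mult_iff)
  moreover have "f' t \<le> 0" using t fy y by (simp add: f_def) (smt (verit) mult_pos_pos)
  moreover have "t powr (- \<gamma> - 1) < r powr (- \<gamma> - 1)"
    using r t y \<gamma> by (intro powr_less_mono2_neg) auto
  then have "f' r < f' t" unfolding f'_def using a \<gamma> by simp
  ultimately show False by simp
qed

text \<open>First and second derivative, with respect to \<open>y\<close>, of the right-hand side
  \<open>y (y - 1 + a (y\<^sup>-\<^sup>\<gamma> - 1))\<close> of the profile equation.\<close>
definition profile_b :: "real \<Rightarrow> real \<Rightarrow> real \<Rightarrow> real" where
  "profile_b \<gamma> a y = 2 * y - 1 - a - a * (\<gamma> - 1) * y powr (- \<gamma>)"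

definition profile_B :: "real \<Rightarrow> real \<Rightarrow> real \<Rightarrow> real" where
  "profile_B \<gamma> a y = 2 + a * \<gamma> * (\<gamma> - 1) * y powr (- \<gamma> - 1)"

lemma has_derivative_profile_speed:
  assumes "0 < y"
  shows "((\<lambda>y. y * (y - 1 + a * (y powr (- \<gamma>) - 1))) has_real_derivative profile_b \<gamma> a y) (at y)"
proof -
  have "y * (a * (- \<gamma> * y powr (- \<gamma> - 1))) = - \<gamma> * a * y powr (- \<gamma>)"
    using assms by (simp add: powr_diff)
  then show ?thesis
    using assms by (auto intro!: derivative_eq_intros simp: profile_b_def algebra_simps)
qed

lemma has_derivative_profile_b:
  assumes "0 < y"
  shows "(profile_b \<gamma> a has_real_derivative profile_B \<gamma> a y) (at y)"
  using assms unfolding profile_b_def[abs_def] profile_B_def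
  by (auto intro!: derivative_eq_intros)

text \<open>As \<open>vp \<rightarrow> 1\<close> the parameter \<open>a\<close> tends to \<open>1 / \<gamma>\<close>, exactly the value for which the first derivative \<open>b\<close> vanishes at
  \<open>y = 1\<close>: the end state of a vanishing layer is sonic.\<close>
lemma profile_small:
  assumes \<gamma>: "1 \<le> \<gamma>" and \<theta>: "0 < \<theta>" "\<theta> \<le> 1 / 10"
  shows "\<exists>\<epsilon>>0. \<forall>vp. 0 < vp \<longrightarrow> 1 - \<epsilon> < vp \<longrightarrow> vp < 1 \<longrightarrow> 9 / 10 \<le> vp \<and>
    (\<forall>y. vp \<le> y \<longrightarrow> y \<le> 1 \<longrightarrow>
      \<bar>profile_b \<gamma> (profile_a \<gamma> vp) y\<bar> \<le> \<theta> \<and>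
      1 \<le> profile_B \<gamma> (profile_a \<gamma> vp) y \<and>
      - (y * (y - 1 + profile_a \<gamma> vp * (y powr (- \<gamma>) - 1))) \<le> \<theta> \<and>
      profile_B \<gamma> (profile_a \<gamma> vp) y * - (y * (y - 1 + profile_a \<gamma> vp * (y powr (- \<gamma>) - 1))) \<le> 1 / 10)"
proof -
  \<comment> \<open>The second derivative \<open>B\<close> grows like \<open>\<gamma>\<^sup>2\<close>, hence the factor in the admissible amplitude.\<close>
  define \<kappa> where "\<kappa> = \<theta> / (20 * \<gamma>\<^sup>2)"
  have g2: "1 \<le> \<gamma>\<^sup>2" "\<gamma> \<le> \<gamma>\<^sup>2" using \<gamma> by (auto intro: one_le_power self_le_power)
  have \<kappa>: "0 < \<kappa>" "\<kappa> * (20 * \<gamma>\<^sup>2) = \<theta>" using \<gamma> \<theta> by (simp_all add: \<kappa>_def)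
  have \<kappa>1: "20 * \<kappa> \<le> \<theta>"
  proof -
    have "20 * \<kappa> * 1 \<le> 20 * \<kappa> * \<gamma>\<^sup>2" using g2 \<kappa> by (intro mult_left_mono) auto
    then show ?thesis using \<kappa>(2) by (simp only: mult_ac mult_1_left)
  qed
  have "((\<lambda>y. y powr (- \<gamma>)) \<longlongrightarrow> 1 powr (- \<gamma>)) (at_left 1)" by (intro tendsto_intros) auto
  from order_tendstoD(2)[OF this, of "1 + \<kappa>"] tendstoD[OF profile_a_tendsto[OF \<gamma>] \<kappa>(1)]
  have "\<forall>\<^sub>F vp in at_left 1. vp powr (- \<gamma>) < 1 + \<kappa> \<and> \<bar>profile_a \<gamma> vp - 1 / \<gamma>\<bar> < \<kappa>"
    using \<kappa>(1) by (auto intro: eventually_conj simp: dist_real_def)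
  then obtain t where t: "t < 1" "\<And>vp. t < vp \<Longrightarrow> vp < 1 \<Longrightarrow> vp powr (- \<gamma>) < 1 + \<kappa> \<and> \<bar>profile_a \<gamma> vp - 1 / \<gamma>\<bar> < \<kappa>"
    using eventually_at_left[of 0 "1::real"] by auto
  show ?thesis
  proof (intro exI[of _ "min (1 - t) \<kappa>"] conjI allI impI)
    show "0 < min (1 - t) \<kappa>" using t \<kappa> by simp
    fix vp :: real assume vp: "0 < vp" "1 - min (1 - t) \<kappa> < vp" "vp < 1"
    define a where "a = profile_a \<gamma> vp"
    have t': "vp powr (- \<gamma>) < 1 + \<kappa>" "\<bar>a - 1 / \<gamma>\<bar> < \<kappa>" using t(2)[of vp] vp by (auto simp: a_def)
    have vp9: "1 - \<kappa> < vp" using vp by simp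
    show "9 / 10 \<le> vp" using vp9 \<kappa>1 \<theta> by linarith
    have vp1: "vp powr \<gamma> < 1" using vp \<gamma> powr_less_mono2[of \<gamma> vp 1] by simp
    have a0: "0 < a" unfolding a_def profile_a_def using vp vp1 by simp
    have "1 / \<gamma> \<le> 1" using \<gamma> by simp
    then have a2: "a \<le> 2" using t'(2) \<kappa>1 \<theta> by linarith
    fix y assume y: "vp \<le> y" "y \<le> 1"
    define r where "r = y powr (- \<gamma>) - 1"
    have r: "0 \<le> r" "r \<le> \<kappa>"
    proof -
      show "0 \<le> r" unfolding r_def using powr_mono2'[of "-\<gamma>" y 1] y vp \<gamma> by simp
      have "y powr (- \<gamma>) \<le> vp powr (- \<gamma>)" using powr_mono2'[of "-\<gamma>" vp y] y vp \<gamma> by simp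
      then show "r \<le> \<kappa>" using t' by (simp add: r_def)
    qed
    have ar: "0 \<le> a * r" "a * r \<le> 2 * \<kappa>" using a0 a2 r by (auto intro: mult_mono)
    have c1: "\<bar>profile_b \<gamma> a y\<bar> \<le> \<theta>"
    proof -
      have small: "\<gamma> * \<kappa> \<le> \<theta> / 20"

      proof -
        have "\<gamma> * \<kappa> \<le> \<gamma>\<^sup>2 * \<kappa>" using g2 \<kappa> by (intro mult_right_mono) auto
        moreover have "\<gamma>\<^sup>2 * \<kappa> = \<theta> / 20" using \<kappa>(2) by (simp add: mult_ac)
        ultimately show ?thesis by simp
      qed
      define X where "X = \<gamma> * (a - 1 / \<gamma>)"
      define Y where "Y = (\<gamma> - 1) * (a * r)"
      have "\<bar>X\<bar> \<le> \<gamma> * \<kappa>" using t' \<gamma> unfolding X_def abs_mult by (intro mult_mono) auto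
      then have "X \<le> \<theta> / 20" "- X \<le> \<theta> / 20" using small by linarith+
      moreover have "Y \<le> \<gamma> * (2 * \<kappa>)" unfolding Y_def by (rule mult_mono) (use ar \<gamma> in auto)
      then have "Y \<le> \<theta> / 10" using small by simp
      moreover have "0 \<le> Y" using ar \<gamma> by (simp add: Y_def)
      moreover have "profile_b \<gamma> a y = 2 * (y - 1) - X - Y"
        using \<gamma> unfolding profile_b_def r_def X_def Y_def by (simp add: field_simps)
      ultimately show ?thesis using y vp9 \<kappa>1 \<theta>(1) by (intro abs_leI; simp)
    qed
    have "a * \<gamma> * (\<gamma> - 1) * y powr (- \<gamma> - 1) \<le> 2 * \<gamma> * \<gamma> * 2"
    proof (intro mult_mono)
      have "y powr (- \<gamma> - 1) = (1 + r) / y" using y vp by (simp add: r_def powr_diff)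
      also have "\<dots> \<le> (1 + \<kappa>) / (9/10)" using r y vp9 \<kappa>1 \<theta> by (intro frac_le) auto
      finally show "y powr (- \<gamma> - 1) \<le> 2" using \<kappa>1 \<theta> by simp
    qed (use a0 a2 \<gamma> in auto)
    then have B: "profile_B \<gamma> a y \<le> 6 * \<gamma>\<^sup>2" unfolding profile_B_def using g2 by (simp add: power2_eq_square)
    have c2: "1 \<le> profile_B \<gamma> a y" unfolding profile_B_def using a0 \<gamma> by simp
    define s where "s = - (y * (y - 1 + a * (y powr (- \<gamma>) - 1)))"
    have "s = y * (1 - y) - y * (a * r)" unfolding s_def r_def by (simp add: algebra_simps)
    also have "\<dots> \<le> 1 * \<kappa> - 0" using y vp9 vp ar by (intro diff_mono mult_mono) auto
    finally have s: "s \<le> \<kappa>" by simp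
    then have c3: "s \<le> \<theta>" using \<kappa>1 \<kappa> by simp
    have "profile_B \<gamma> a y * s \<le> profile_B \<gamma> a y * \<kappa>"
      using s c2 by (intro mult_left_mono) auto
    also have "\<dots> \<le> 6 * \<gamma>\<^sup>2 * \<kappa>" using B \<kappa> by (intro mult_right_mono) auto
    also have "\<dots> \<le> 1 / 10" using \<kappa> \<theta> by (simp add: mult_ac)
    finally have c4: "profile_B \<gamma> a y * s \<le> 1 / 10" .
    from c1 show "\<bar>profile_b \<gamma> (profile_a \<gamma> vp) y\<bar> \<le> \<theta>" by (simp add: a_def)
    from c2 show "1 \<le> profile_B \<gamma> (profile_a \<gamma> vp) y" by (simp add: a_def)
    from c3 show "- (y * (y - 1 + profile_a \<gamma> vp * (y powr (- \<gamma>) - 1))) \<le> \<theta>"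
      unfolding s_def a_def .
    from c4 show "profile_B \<gamma> (profile_a \<gamma> vp) y * - (y * (y - 1 + profile_a \<gamma> vp * (y powr (- \<gamma>) - 1))) \<le> 1 / 10"
      unfolding s_def a_def .
  qed
qed

lemma profile_bounds:
  assumes "compressive_outflow_profile \<gamma> v0 vp vh"
  shows "vp < vh x" "vh x < 1"
proof -
  have mono: "vh y < vh x" if "x < y" for x y
    using assms that by (auto simp: compressive_outflow_profile_def monotone_def)
  have lim: "(vh \<longlongrightarrow> 1) at_bot" "(vh \<longlongrightarrow> vp) at_top"
    using assms by (auto simp: compressive_outflow_profile_def)
  have "vh (x - 1) \<le> 1"
    by (rule tendsto_lowerbound[OF lim(1)])
       (auto simp: eventually_at_bot_linorder intro!: exI[of _ "x - 2"] less_imp_le mono)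
  then show "vh x < 1" using mono[of "x - 1" x] by simp
  have "vp \<le> vh (x + 1)"
    by (rule tendsto_upperbound[OF lim(2)])
       (auto simp: eventually_at_top_linorder intro!: exI[of _ "x + 2"] less_imp_le mono)
  then show "vp < vh x" using mono[of x "x + 1"] by simp
qed

text \<open>This identity is what makes the coefficient of \<open>V\<close> in the integrated system equal to \<open>w - b\<close>, with the same
  \<open>b\<close> that governs the slope of the profile.\<close>
lemma flux_coefficient:
  assumes "0 < y"
  shows "y * (outflow_h \<gamma> vp y / y powr (\<gamma> + 1)) = y - profile_b \<gamma> (profile_a \<gamma> vp) y"
proof -
  have "y powr (\<gamma> + 1) = y * y powr \<gamma>" using assms by (simp add: powr_add)
  then show ?thesis using assms unfolding outflow_h_def profile_b_def powr_minus
    by (simp add: field_simps)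
qed

section \<open>Spectral stability\<close>
lemma no_eigenfunction:
  assumes \<gamma>: "1 \<le> \<gamma>" and vp: "0 < vp"
    and prof: "compressive_outflow_profile \<gamma> v0 vp vh"
    and small: "9 / 10 \<le> vp"
      "\<And>y. vp \<le> y \<Longrightarrow> y \<le> 1 \<Longrightarrow>
      \<bar>profile_b \<gamma> (profile_a \<gamma> vp) y\<bar> \<le> \<beta> \<and>
      1 \<le> profile_B \<gamma> (profile_a \<gamma> vp) y \<and>
      - (y * (y - 1 + profile_a \<gamma> vp * (y powr (- \<gamma>) - 1))) \<le> \<beta> \<and>
      profile_B \<gamma> (profile_a \<gamma> vp) y * - (y * (y - 1 + profile_a \<gamma> vp * (y powr (- \<gamma>) - 1))) \<le> 1 / 10"
    and lam: "lam \<noteq> 0" "0 \<le> Re lam"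
    and eig: "outflow_eigenfunction \<gamma> vp vh lam v u"
  shows False
proof -
  define a where "a = profile_a \<gamma> vp"
  note range = profile_bounds[OF prof]
  have pos: "0 < vh x" for x using range(1)[of x] vp by linarith
  define s where "s x = - (vh x * (vh x - 1 + a * (vh x powr (- \<gamma>) - 1)))" for x
  define b where "b x = profile_b \<gamma> a (vh x)" for x
  define B where "B x = profile_B \<gamma> a (vh x)" for x
  have dw: "(vh has_real_derivative - s x) (at x)" for x
    using prof by (simp add: compressive_outflow_profile_def s_def a_def)
  have ds: "(s has_real_derivative b x * s x) (at x)" for x
    using DERIV_minus[OF DERIV_chain2[OF has_derivative_profile_speed[OF pos] dw]]
    unfolding s_def[abs_def] b_def by simp
  have db: "(b has_real_derivative - B x * s x) (at x)" for x
    using DERIV_chain2[OF has_derivative_profile_b[OF pos] dw] unfolding b_def[abs_def] B_def by simp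
  have spos: "0 < s x" for x
    using profile_speed_neg[OF \<gamma> vp range, of x] pos[of x]
    by (simp add: s_def a_def mult_pos_neg)
  have bounds: "\<bar>b x\<bar> \<le> \<beta>" "1 \<le> B x" "s x \<le> \<beta>" "B x * s x \<le> 1 / 10" for x
    using small(2)[of "vh x"] range[of x] unfolding b_def B_def s_def a_def by auto
  define H where "H x = outflow_h \<gamma> vp (vh x) / vh x powr (\<gamma> + 1)" for x
  have wH: "vh x * H x = vh x - b x" for x
    unfolding H_def b_def a_def using flux_coefficient[OF pos] .
  obtain v' u' p' q' where eqs: "\<And>x. x < 0 \<Longrightarrow> (v has_vector_derivative v' x) (at x)"
      "\<And>x. x < 0 \<Longrightarrow> (u has_vector_derivative u' x) (at x)"
      "\<And>x. x < 0 \<Longrightarrow> ((\<lambda>y. of_real (H y) * v y) has_vector_derivative p' x) (at x)"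
      "\<And>x. x < 0 \<Longrightarrow> ((\<lambda>y. u' y / of_real (vh y)) has_vector_derivative q' x) (at x)"
      "\<And>x. x < 0 \<Longrightarrow> lam * v x + v' x - u' x = 0"
      "\<And>x. x < 0 \<Longrightarrow> lam * u x + u' x - p' x = q' x"
    using eig unfolding outflow_eigenfunction_def H_def by blast
  have cont: "continuous_on {..0} v" "continuous_on {..0} u"
    and bc0: "u 0 = outflow_alpha vh lam * v 0"
    and lim: "(v \<longlongrightarrow> 0) at_bot" "(u \<longlongrightarrow> 0) at_bot"
    and nontriv: "\<exists>x\<le>0. v x \<noteq> 0 \<or> u x \<noteq> 0"
    using eig unfolding outflow_eigenfunction_def by auto
  define V where "V x = (u x - v x) / lam" for x
  define U1 where "U1 x = (u' x / of_real (vh x) + of_real (H x) * v x - u x) / lam" for x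
  have v: "v x = u x - lam * V x" for x using lam by (simp add: V_def)
  have dV: "(V has_vector_derivative (u x - lam * V x)) (at x)" if x: "x < 0" for x
  proof -
    have "(V has_vector_derivative (u' x - v' x) / lam) (at x)"
      unfolding V_def[abs_def] by (intro derivative_intros eqs x)
    moreover have "(u' x - v' x) / lam = v x" using eqs(5)[OF x] lam(1) by (simp add: field_simps)
    ultimately show ?thesis using v by simp
  qed
  have dU1: "(U1 has_vector_derivative u x) (at x)" if x: "x < 0" for x
  proof -
    have "(U1 has_vector_derivative (q' x + p' x - u' x) / lam) (at x)"
      unfolding U1_def[abs_def] by (intro derivative_intros eqs x)
    moreover have "(q' x + p' x - u' x) / lam = u x" using eqs(6)[OF x] lam(1) by (simp add: field_simps)
    ultimately show ?thesis by simp
  qed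
  have u': "u' x = of_real (b x) * u x + lam * (of_real (vh x) * U1 x + of_real (vh x - b x) * V x)" for x
  proof -
    have "u' x = of_real (vh x) * (lam * U1 x + u x - of_real (H x) * v x)"
      using lam(1) pos[of x] by (simp add: U1_def)
    also have "\<dots> = of_real (vh x) * (lam * U1 x + u x) - of_real (vh x * H x) * (u x - lam * V x)"
      unfolding v by (simp add: algebra_simps)
    finally show ?thesis unfolding wH by (simp add: algebra_simps)
  qed
  \<comment> \<open>\<open>U1\<close> has a meaning only for \<open>x < 0\<close>, as \<open>u'\<close> is unspecified at the wall.\<close>
  obtain L where L: "continuous_on {..0} (\<lambda>x. if x < 0 then U1 x else L)"
    using extends_continuously[OF dU1 cont(2)] by blast
  define U where "U x = (if x < 0 then U1 x else L)" for x
  have dU: "(U has_vector_derivative u x) (at x)" if "x < 0" for x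
    by (rule has_vector_derivative_transform_within_open[OF dU1[OF that], of "{..<0}"])
       (use that in \<open>auto simp: U_def\<close>)
  have du: "(u has_vector_derivative
      (of_real (b x) * u x + lam * (of_real (vh x) * U x + of_real (vh x - b x) * V x))) (at x)" if "x < 0" for x
    using eqs(2)[OF that] u'[of x] that by (simp add: U_def)
  have limV: "(V \<longlongrightarrow> 0) at_bot"
    using tendsto_divide[OF tendsto_diff[OF lim(2,1)] tendsto_const[of lam]] lam unfolding V_def by simp
  have w: "9 / 10 \<le> vh x" "vh x \<le> 1" for x using range[of x] small(1) by auto
  have b10: "\<bar>b x\<bar> \<le> 1 / 10" for x
    by (rule order.trans[OF bounds(1)]) (use \<beta>_small in simp)
  interpret integrated_mode lam U V u vh s b B
  proof
    show "continuous_on {..0} U" using L by (simp add: U_def[abs_def])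
    show "continuous_on {..0} V" unfolding V_def using lam(1) by (intro continuous_intros cont) auto
    show "(U \<longlongrightarrow> 0) at_bot"
      by (rule integrated_velocity_tendsto_zero[OF lam(1) dU du b10 w limV lim(2)])
    \<comment> \<open>The quotient \<open>s(0) / (\<lambda> + s(0))\<close> in the boundary condition is what the integration absorbs.\<close>
    show "u 0 = - of_real (s 0) * V 0"
    proof -
      have "deriv vh 0 = - s 0" by (rule DERIV_imp_deriv[OF dw])
      then have bc: "u 0 = of_real (s 0) / (lam + of_real (s 0)) * v 0"
        using bc0 by (simp add: outflow_alpha_def)
      have "Re (lam + of_real (s 0)) \<noteq> 0" using lam(2) spos[of 0] by simp
      then have "lam + of_real (s 0) \<noteq> 0" by force
      then have "u 0 * (lam + of_real (s 0)) = of_real (s 0) * v 0" unfolding bc by simp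
      then have "lam * u 0 = - of_real (s 0) * (u 0 - v 0)" by (simp add: algebra_simps)
      then show ?thesis using lam(1) by (simp add: V_def field_simps)
    qed
  qed (use lam cont dU dV du dw ds db spos bounds w limV lim in auto)
  show False using nontriv mode_is_trivial v by force
qed

theorem proposition3p7:
  fixes \<gamma> :: real
  assumes "\<gamma> \<ge> 1"
  shows "\<exists>\<epsilon>>0. \<forall>vp v0 vh.
           0 < vp \<longrightarrow> 1 - \<epsilon> < vp \<longrightarrow> vp < v0 \<longrightarrow> v0 < 1 \<longrightarrow>
           compressive_outflow_profile \<gamma> v0 vp vh \<longrightarrow>
           outflow_spectrally_stable \<gamma> vp vh"
proof -
  have "0 < \<beta>" "\<beta> \<le> 1 / 10" using \<beta>_small by simp_all
  from profile_small[OF assms this] obtain \<epsilon> where \<epsilon>: "0 < \<epsilon>" and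
    small: "\<And>vp. 0 < vp \<Longrightarrow> 1 - \<epsilon> < vp \<Longrightarrow> vp < 1 \<Longrightarrow> 9 / 10 \<le> vp \<and>
    (\<forall>y. vp \<le> y \<longrightarrow> y \<le> 1 \<longrightarrow>
      \<bar>profile_b \<gamma> (profile_a \<gamma> vp) y\<bar> \<le> \<beta> \<and>
      1 \<le> profile_B \<gamma> (profile_a \<gamma> vp) y \<and>
      - (y * (y - 1 + profile_a \<gamma> vp * (y powr (- \<gamma>) - 1))) \<le> \<beta> \<and>
      profile_B \<gamma> (profile_a \<gamma> vp) y * - (y * (y - 1 + profile_a \<gamma> vp * (y powr (- \<gamma>) - 1))) \<le> 1 / 10)"
    by blast
  show ?thesis
  proof (intro exI[of _ \<epsilon>] conjI allI impI \<epsilon>)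
    fix vp v0 vh
    assume vp: "0 < vp" "1 - \<epsilon> < vp" "vp < v0" "v0 < 1" and prof: "compressive_outflow_profile \<gamma> v0 vp vh"
    have "vp < 1" using vp by simp
    note sm = small[OF vp(1,2) this]
    show "outflow_spectrally_stable \<gamma> vp vh"
      unfolding outflow_spectrally_stable_def outflow_eigenvalue_def
      using no_eigenfunction[OF assms vp(1) prof] sm by blast
  qed
qed

end
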